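(* Let $N\ge 9$ and let $u^*$ be the extremal solution of $(P)_\lambda$ on the unit ball $B\subset\mathbb{R}^N$. Then $$u^*(x)\le 1-|x|^{4/3}\qquad\text{in }B.$$
   Context: $B$ is the open unit ball of $\mathbb{R}^N$ and $\partial_\nu$ is the outer normal derivative on $\partial B$. For $\lambda>0$, $(P)_\lambda$ denotes the problem $$\Delta^2u=\frac{\lambda}{(1-u)^2}\ \text{in }B,\qquad 0<u<1\ \text{in }B,\qquad u=\partial_\nu u=0\ \text{on }\partial B.$$ The pull-in voltage is $\lambda^*:=\sup\{\lambda>0:\ (P)_\lambda\text{ has a classical solution}\}$. It is known that $0<\lambda^*<\infty$, that for each $0<\lambda<\lambda^*$ there is a classical minimal solution $u_\lambda$ of $(P)_\lambda$ (pointwise below every other classical solution), that $u_\lambda$ is radial and radially decreasing, and that $\lambda\mapsto u_\lambda(x)$ is strictly increasing on $(0,\lambda^* )$ for each $x\in B$. The extremal solution is $u^*(x):=\lim_{\lambda\nearrow\lambda^*}u_\lambda(x)$. *)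

theory Defs imports "HOL-Analysis.Analysis" begin

(* Derivatives are taken within S, so that for open S this is the usual class C^k(S), while for
   the closed ball it is C^k up to the boundary with one-sided derivatives at boundary points. *)
primrec C_k_on :: "nat \<Rightarrow> ('a::euclidean_space \<Rightarrow> real) \<Rightarrow> 'a set \<Rightarrow> bool" where
  "C_k_on 0 f S \<longleftrightarrow> continuous_on S f"
| "C_k_on (Suc k) f S \<longleftrightarrow>
     f differentiable_on S \<and>
     (\<forall>e\<in>Basis. C_k_on k (\<lambda>x. frechet_derivative f (at x within S) e) S)"

definition partial_deriv :: "'a::euclidean_space \<Rightarrow> ('a \<Rightarrow> real) \<Rightarrow> 'a \<Rightarrow> real" where
  "partial_deriv e u x = frechet_derivative u (at x) e"

definition laplacian :: "('a::euclidean_space \<Rightarrow> real) \<Rightarrow> 'a \<Rightarrow> real" where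
  "laplacian u x = (\<Sum>e\<in>Basis. partial_deriv e (partial_deriv e u) x)"

(* The outer unit normal of the unit ball at a boundary point x is x itself. *)
definition normal_deriv :: "('a::euclidean_space \<Rightarrow> real) \<Rightarrow> 'a \<Rightarrow> real" where
  "normal_deriv u x = frechet_derivative u (at x within cball 0 1) x"

(* Classical means C^4 inside and C^1 up to the boundary, the regularity needed to read the
   equation and the boundary conditions pointwise.  Values of u outside the closed unit ball
   are irrelevant. *)
definition classical_solution :: "real \<Rightarrow> ('a::euclidean_space \<Rightarrow> real) \<Rightarrow> bool" where
  "classical_solution l u \<longleftrightarrow>
     C_k_on 4 u (ball 0 1) \<and> C_k_on 1 u (cball 0 1) \<and>
     (\<forall>x\<in>ball 0 1. laplacian (laplacian u) x = l / (1 - u x)\<^sup>2) \<and>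
     (\<forall>x\<in>ball 0 1. 0 < u x \<and> u x < 1) \<and>
     (\<forall>x\<in>sphere 0 1. u x = 0 \<and> normal_deriv u x = 0)"

definition minimal_solution :: "real \<Rightarrow> ('a::euclidean_space \<Rightarrow> real) \<Rightarrow> bool" where
  "minimal_solution l u \<longleftrightarrow>
     classical_solution l u \<and>
     (\<forall>v. classical_solution l v \<longrightarrow> (\<forall>x\<in>ball 0 1. u x \<le> v x))"

(* The type argument carries the dimension of the ambient space. *)
definition pull_in_voltage :: "'a::euclidean_space itself \<Rightarrow> real" where
  "pull_in_voltage _ = Sup {l. l > 0 \<and> (\<exists>u :: 'a \<Rightarrow> real. classical_solution l u)}"

(* U l is the minimal solution for the parameter l; its values on the ball are determined
   by minimality, hence so are those of the extremal solution. *)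
definition extremal_solution :: "('a::euclidean_space \<Rightarrow> real) \<Rightarrow> bool" where
  "extremal_solution w \<longleftrightarrow>
     (\<exists>U :: real \<Rightarrow> 'a \<Rightarrow> real.
        (\<forall>l. 0 < l \<and> l < pull_in_voltage TYPE('a) \<longrightarrow> minimal_solution l (U l)) \<and>
        (\<forall>x\<in>ball 0 1. ((\<lambda>l. U l x) \<longlongrightarrow> w x) (at_left (pull_in_voltage TYPE('a)))))"

end

(*
  Write lb = 8/9 (N - 2/3) (N - 8/3), the parameter for which w = 1 - |x|^(4/3) solves the equation off the origin.

  For 0 < l <= lb the radial Dirichlet problem is solved by a contraction on {0 <= v <= 1/3}, and the solution
  is at most (1 - |x|^2)^2 / 4 <= w.  Minimality gives the bound for these l, and also lb <= lambda*.  Testing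
  the equation against a bump function bounds all admissible l, so that the supremum is a genuine one.

  For l >= lb the minimal solution u is radial, because its reflections are solutions too.  If u > w somewhere,
  then d = w - u has a last zero R < 1 with d'(R) >= 0, since the slopes on the unit sphere are 0 and -4/3.
  By convexity of y^(-2), k = r^(N/2-2) d satisfies on (0, R] the linear Euler inequality
     (T^2 - m^2) (T^2 - n^2) k <= 0,   T = r d/dr.
  For N >= 9, the Hardy-Rellich range, m and n are real, and n < N/2 - 2.  Integrating the four first-order
  factors from r = 0 forces k = 0 on (0, R], contradicting d(0) = 1 - u(0) > 0.
*)

theory Submission imports Defs begin

section \<open>The classes C^k and the Laplacian\<close>

text \<open>The split at lb comes from the term (lb - l) / (1 - u)^2 in the equation for d: for l >=
  lb it has the favourable sign, for l < lb it has not, and there a solution lying under w is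
  constructed and minimality does the comparison. In the case l >= lb no maximum principle is
  invoked: on (0, R] the only data are the smoothness of u at 0 and the two signs at R. The
  inequality there is solvable by hand because 1 - w = r^(4/3) has cube r^4, so the linearisation of
  lb / y^2 at y = 1 - w has the scale-invariant coefficient 2 lb / r^4 and every term is of Euler
  type. The roots m and n are both real exactly when 2 lb <= N^2 (N - 4)^2 / 16, the Hardy-Rellich
  constant; this holds from N = 9 on and fails at N = 8, where 2 lb > 69 against 64. Factorising the
  operator takes the place of an energy estimate.\<close>

definition unique_derivs :: "'a::euclidean_space set \<Rightarrow> bool" where
  "unique_derivs S \<longleftrightarrow> (\<forall>x\<in>S. \<forall>(f :: 'a \<Rightarrow> real) D D'.
     (f has_derivative D) (at x within S) \<longrightarrow> (f has_derivative D') (at x within S) \<longrightarrow> D = D')"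

lemma unique_derivs_open: "open S \<Longrightarrow> unique_derivs S"
  unfolding unique_derivs_def using has_derivative_unique by (metis at_within_open)

text \<open>\<open>frechet_derivative\<close> is a choice, so computing with \<open>C_k_on\<close>
  up to the boundary requires a unique derivative within the closed ball. By convexity D and D'
  agree on every y - x with y in the ball; y = 0 settles x itself, and unit vectors y then settle
  all directions.\<close>

lemma unique_derivs_cball: "unique_derivs (cball (0::'a::euclidean_space) 1)"
proof -
  have "D = D'" if x: "x \<in> cball 0 1" and D: "(f has_derivative D) (at x within cball 0 1)"
    and D': "(f has_derivative D') (at x within cball 0 1)" for x :: 'a and f :: "'a \<Rightarrow> real" and D D'
  proof -
    interpret D: bounded_linear D using D by (rule has_derivative_bounded_linear)
    interpret D': bounded_linear D' using D' by (rule has_derivative_bounded_linear)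
    have seg: "D (y - x) = D' (y - x)" if y: "y \<in> cball 0 1" for y
    proof -
      let ?p = "\<lambda>t::real. x + t *\<^sub>R (y - x)"
      have img: "?p ` {0..1} \<subseteq> cball 0 1"
      proof safe
        fix t :: real assume t: "t \<in> {0..1}"
        have "?p t = (1 - t) *\<^sub>R x + t *\<^sub>R y" by (simp add: algebra_simps)
        also have "\<dots> \<in> cball 0 1"
          using t x y by (intro convexD[OF convex_cball]) auto
        finally show "?p t \<in> cball 0 1" .
      qed
      have p: "(?p has_derivative (\<lambda>t. t *\<^sub>R (y - x))) (at 0 within {0..1})"
        by (auto intro!: derivative_eq_intros)
      have 1: "((f \<circ> ?p) has_vector_derivative E (y - x)) (at 0 within {0..1})"
        if E: "(f has_derivative E) (at x within cball 0 1)" for E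
      proof -
        interpret E: bounded_linear E using E by (rule has_derivative_bounded_linear)
        have "(f has_derivative E) (at (?p 0) within ?p ` {0..1})"
          using E img by (auto intro: has_derivative_subset)
        from diff_chain_within[OF p this] show ?thesis
          by (simp add: has_vector_derivative_def o_def E.scaleR)
      qed
      show ?thesis
        using vector_derivative_unique_within_closed_interval[of 0 1 0] 1[OF D] 1[OF D'] by simp
    qed
    have "D y = D' y" for y
    proof (cases "y = 0")
      case False
      have z: "D x = D' x" using seg[of 0] by (simp add: D.neg D'.neg)
      have "D (y /\<^sub>R norm y) = D' (y /\<^sub>R norm y)"
        using seg[of "y /\<^sub>R norm y"] False z by (simp add: D.diff D'.diff)
      then show ?thesis using False by (simp add: D.scaleR D'.scaleR)
    qed (simp add: D.zero D'.zero)
    then show ?thesis by blast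
  qed
  then show ?thesis unfolding unique_derivs_def by blast
qed

lemma frechet_derivative_within_eq:
  assumes "unique_derivs S" "x \<in> S" "(f has_derivative D) (at x within S)"
  shows "frechet_derivative f (at x within S) = (D :: 'a::euclidean_space \<Rightarrow> real)"
  using assms frechet_derivative_works[of f "at x within S"] differentiableI[OF assms(3)]
  unfolding unique_derivs_def by blast

lemma C_k_on_has_derivative:
  "C_k_on (Suc k) f S \<Longrightarrow> x \<in> S \<Longrightarrow>
   (f has_derivative frechet_derivative f (at x within S)) (at x within S)"
  using frechet_derivative_works by (auto simp: differentiable_on_def)

lemma C_k_on_cong:
  assumes "\<And>x. x \<in> S \<Longrightarrow> f x = g x" shows "C_k_on k f S = C_k_on k g S"
  using assms
proof (induction k arbitrary: f g)
  case (Suc k)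
  have d: "(f has_derivative D) (at x within S) \<longleftrightarrow> (g has_derivative D) (at x within S)" if "x \<in> S" for x D
    using that Suc.prems has_derivative_transform[of x S f g D] has_derivative_transform[of x S g f D] by auto
  then have "frechet_derivative f (at x within S) = frechet_derivative g (at x within S)" if "x \<in> S" for x
    using that unfolding frechet_derivative_def by simp
  moreover have "f differentiable_on S \<longleftrightarrow> g differentiable_on S"
    using d by (simp add: differentiable_on_def differentiable_def)
  ultimately show ?case
    using Suc.IH[of "\<lambda>x. frechet_derivative f (at x within S) e" "\<lambda>x. frechet_derivative g (at x within S) e" for e]
    by simp
qed (simp cong: continuous_on_cong)

text \<open>Lets an explicitly computed derivative stand in for the chosen one; the inductive
  closure properties that follow pass through this rule.\<close>

lemma C_k_on_SucI:
  assumes "unique_derivs S" and D: "\<And>x. x \<in> S \<Longrightarrow> (f has_derivative D x) (at x within S)"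
    and C: "\<And>e. e \<in> Basis \<Longrightarrow> C_k_on k (\<lambda>x. D x e) S"
  shows "C_k_on (Suc k) f S"
proof -
  have "D x e = frechet_derivative f (at x within S) e" if "x \<in> S" for x e
    using frechet_derivative_within_eq[OF assms(1) that D[OF that]] by simp
  then have "C_k_on k (\<lambda>x. D x e) S = C_k_on k (\<lambda>x. frechet_derivative f (at x within S) e) S" for e
    by (rule C_k_on_cong)
  then show ?thesis
    using D C by (auto simp: differentiable_on_def differentiable_def)
qed

lemma C_k_on_SucD: "C_k_on (Suc k) f S \<Longrightarrow> C_k_on k f S"
proof (induction k arbitrary: f)
  case 0 then show ?case by (simp add: differentiable_imp_continuous_on)
next
  case (Suc k)
  from Suc.prems have "f differentiable_on S"
    "\<forall>e\<in>Basis. C_k_on (Suc k) (\<lambda>x. frechet_derivative f (at x within S) e) S"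
    unfolding C_k_on.simps(2)[of "Suc k"] by blast+
  with Suc.IH show ?case by (simp only: C_k_on.simps(2)[of k]) simp
qed

lemma C_k_on_le: "C_k_on n f S \<Longrightarrow> k \<le> n \<Longrightarrow> C_k_on k f S"
proof (induction n)
  case (Suc n)
  then show ?case using C_k_on_SucD[of n f S] by (metis le_Suc_eq)
qed simp

lemma C_k_on_partial:
  "C_k_on (Suc k) f S \<Longrightarrow> e \<in> Basis \<Longrightarrow> C_k_on k (\<lambda>x. frechet_derivative f (at x within S) e) S"
  by simp

lemma C_k_on_const: "unique_derivs S \<Longrightarrow> C_k_on k (\<lambda>x. c) S"
proof (induction k arbitrary: c)
  case (Suc k)
  then show ?case by (intro C_k_on_SucI[where D="\<lambda>x h. 0"]) auto
qed simp

lemma C_k_on_add: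
  "unique_derivs S \<Longrightarrow> C_k_on k f S \<Longrightarrow> C_k_on k g S \<Longrightarrow> C_k_on k (\<lambda>x. f x + g x) S"
proof (induction k arbitrary: f g)
  case (Suc k)
  show ?case
    by (rule C_k_on_SucI[OF Suc.prems(1) has_derivative_add[OF C_k_on_has_derivative[OF Suc.prems(2)]
          C_k_on_has_derivative[OF Suc.prems(3)]]], assumption, assumption,
        intro Suc.IH Suc.prems(1) C_k_on_partial[OF Suc.prems(2)] C_k_on_partial[OF Suc.prems(3)])
qed (auto intro: continuous_intros)

lemma C_k_on_sum:
  "finite I \<Longrightarrow> unique_derivs S \<Longrightarrow> (\<And>i. i \<in> I \<Longrightarrow> C_k_on k (f i) S) \<Longrightarrow> C_k_on k (\<lambda>x. \<Sum>i\<in>I. f i x) S"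
proof (induct I rule: finite_induct)
  case (insert i I)
  then show ?case by (simp add: C_k_on_add)
qed (simp add: C_k_on_const)

lemma C_k_on_mult:
  "unique_derivs S \<Longrightarrow> C_k_on k f S \<Longrightarrow> C_k_on k g S \<Longrightarrow> C_k_on k (\<lambda>x. f x * g x) S"
proof (induction k arbitrary: f g)
  case (Suc k)
  show ?case
    by (rule C_k_on_SucI[OF Suc.prems(1) has_derivative_mult[OF C_k_on_has_derivative[OF Suc.prems(2)]
          C_k_on_has_derivative[OF Suc.prems(3)]]], assumption, assumption,
        intro C_k_on_add Suc.IH Suc.prems(1) C_k_on_partial[OF Suc.prems(2)] C_k_on_partial[OF Suc.prems(3)]
          C_k_on_SucD[OF Suc.prems(2)] C_k_on_SucD[OF Suc.prems(3)])
qed (auto intro: continuous_intros)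

lemma C_k_on_inner: "unique_derivs S \<Longrightarrow> C_k_on k (\<lambda>x. x \<bullet> a) S"
proof (induction k)
  case (Suc k)
  show ?case
    by (rule C_k_on_SucI[where D="\<lambda>x h. h \<bullet> a"])
       (auto intro!: derivative_eq_intros C_k_on_const Suc.prems)
qed (auto intro: continuous_intros)

lemma C_k_on_compose_linear:
  assumes "unique_derivs S" "bounded_linear Q" "\<And>x. x \<in> S \<Longrightarrow> Q x \<in> S" "C_k_on k f S"
  shows "C_k_on k (\<lambda>x. f (Q x)) S"
  using assms(4)
proof (induction k arbitrary: f)
  case 0
  then show ?case using assms(3) continuous_on_compose2[OF _ linear_continuous_on[OF assms(2)], of S f S]
    by auto
next
  case (Suc k)
  interpret Q: bounded_linear Q by fact
  have d: "((\<lambda>x. f (Q x)) has_derivative (\<lambda>h. frechet_derivative f (at (Q x) within S) (Q h))) (at x within S)"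
    if "x \<in> S" for x
    using that assms(3)
    by (intro has_derivative_in_compose2[where t=S and g=f, OF C_k_on_has_derivative[OF Suc.prems]])
       (auto intro!: Q.has_derivative derivative_eq_intros)
  show ?case
  proof (rule C_k_on_SucI[OF assms(1) d])
    fix e :: 'a assume "e \<in> Basis"
    \<comment> \<open>\<open>C_k_on\<close> controls basis directions only, while \<open>Q e\<close>
      is an arbitrary direction; expanding it in the basis makes the induction hypothesis
      applicable.\<close>
    have "C_k_on k (\<lambda>x. \<Sum>b\<in>Basis. (Q e \<bullet> b) * frechet_derivative f (at (Q x) within S) b) S"
      by (intro C_k_on_sum C_k_on_mult C_k_on_const assms(1) finite_Basis
            Suc.IH[of "\<lambda>x. frechet_derivative f (at x within S) b" for b] C_k_on_partial[OF Suc.prems])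
    also have "?this \<longleftrightarrow> C_k_on k (\<lambda>x. frechet_derivative f (at (Q x) within S) (Q e)) S"
    proof (rule C_k_on_cong)
      fix x assume x: "x \<in> S"
      interpret D: bounded_linear "frechet_derivative f (at (Q x) within S)"
        using has_derivative_bounded_linear[OF C_k_on_has_derivative[OF Suc.prems assms(3)[OF x]]] .
      have "frechet_derivative f (at (Q x) within S) (\<Sum>b\<in>Basis. (Q e \<bullet> b) *\<^sub>R b) =
            (\<Sum>b\<in>Basis. (Q e \<bullet> b) * frechet_derivative f (at (Q x) within S) b)"
        by (simp add: D.sum D.scaleR)
      then show "(\<Sum>b\<in>Basis. (Q e \<bullet> b) * frechet_derivative f (at (Q x) within S) b) =
          frechet_derivative f (at (Q x) within S) (Q e)"
        by (simp add: euclidean_representation)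
    qed
    finally show "C_k_on k (\<lambda>x. frechet_derivative f (at (Q x) within S) (Q e)) S" .
  qed
qed

text \<open>Since x . x never leaves T, a derivative of W within T is enough. With T = [0, 1] this
  means a one-sided derivative at s = 0 serves the origin, and one at s = 1 serves the unit
  sphere.\<close>

lemma has_derivative_radial:
  assumes "(W has_real_derivative w) (at (x \<bullet> x) within T)" "\<And>x. x \<in> S \<Longrightarrow> x \<bullet> x \<in> T"
  shows "((\<lambda>x::'a::euclidean_space. W (x \<bullet> x)) has_derivative (\<lambda>h. w * (2 * (x \<bullet> h)))) (at x within S)"
proof -
  have "(W has_derivative (*) w) (at (x \<bullet> x) within ((\<lambda>x. x \<bullet> x) ` S))"
    using assms by (auto simp: has_field_derivative_def intro: has_derivative_subset)
  moreover have "((\<lambda>x. x \<bullet> x) has_derivative (\<lambda>h. 2 * (x \<bullet> h))) (at x within S)"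
    by (auto intro!: derivative_eq_intros simp: inner_commute)
  ultimately show ?thesis
    using has_derivative_in_compose by blast
qed

lemma has_derivative_radial_open:
  assumes "open S" "x \<in> S" "\<And>x. x \<in> S \<Longrightarrow> x \<bullet> x \<in> T"
    and W: "\<And>s. s \<in> T \<Longrightarrow> (W has_real_derivative w s) (at s within T)"
  shows "((\<lambda>x::'a::euclidean_space. W (x \<bullet> x)) has_derivative (\<lambda>h. w (x \<bullet> x) * (2 * (x \<bullet> h)))) (at x)"
proof -
  have "((\<lambda>x::'a. W (x \<bullet> x)) has_derivative (\<lambda>h. w (x \<bullet> x) * (2 * (x \<bullet> h)))) (at x within S)"
    using assms by (intro has_derivative_radial[of _ _ _ T]) auto
  then show ?thesis by (simp only: at_within_open[OF assms(2,1)])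
qed

text \<open>\<open>W\<close> lists successive derivatives. A partial derivative of W 0 (x . x) is W
  1 (x . x) times a linear function, so the induction shifts the list by one and no parity condition
  at the origin appears.\<close>

lemma C_k_on_radial:
  assumes "unique_derivs S" "\<And>x. x \<in> S \<Longrightarrow> x \<bullet> x \<in> T" "continuous_on T (W k)"
    "\<And>j s. j < k \<Longrightarrow> s \<in> T \<Longrightarrow> (W j has_real_derivative W (Suc j) s) (at s within T)"
  shows "C_k_on k (\<lambda>x::'a::euclidean_space. W 0 (x \<bullet> x)) S"
  using assms(3,4)
proof (induction k arbitrary: W)
  case 0
  then show ?case using assms(2) by (auto intro!: continuous_on_compose2[of T "W 0"] continuous_intros)
next
  case (Suc k)
  show ?case
  proof (rule C_k_on_SucI[OF assms(1)])
    show "((\<lambda>x::'a. W 0 (x \<bullet> x)) has_derivative (\<lambda>h. W 1 (x \<bullet> x) * (2 * (x \<bullet> h)))) (at x within S)"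
      if "x \<in> S" for x
      using that Suc.prems(2)[of 0] assms(2) by (intro has_derivative_radial[of _ _ _ T]) auto
    show "C_k_on k (\<lambda>x. W 1 (x \<bullet> x) * (2 * (x \<bullet> e))) S" for e
      using Suc.IH[of "\<lambda>j. W (Suc j)"] Suc.prems
      by (intro C_k_on_mult assms(1) C_k_on_const C_k_on_inner) auto
  qed
qed

section \<open>Partial derivatives and the Laplacian on open sets\<close>

lemma partial_deriv_eq: "(f has_derivative D) (at x) \<Longrightarrow> partial_deriv e f x = D e"
  by (metis frechet_derivative_at partial_deriv_def)

lemma partial_deriv_cong:
  assumes "open S" "x \<in> S" "\<And>y. y \<in> S \<Longrightarrow> f y = g y"
  shows "partial_deriv e f x = partial_deriv e g x"
proof -
  have "(f has_derivative D) (at x) \<longleftrightarrow> (g has_derivative D) (at x)" for D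
    by (rule iffI; erule has_derivative_transform_within_open[OF _ assms(1,2)]) (simp_all add: assms(3))
  then show ?thesis unfolding partial_deriv_def frechet_derivative_def by simp
qed

lemma laplacian_cong:
  assumes "open S" "x \<in> S" "\<And>y. y \<in> S \<Longrightarrow> f y = g y"
  shows "laplacian f x = laplacian g x"
  unfolding laplacian_def
  by (intro sum.cong refl partial_deriv_cong[OF assms(1,2)]) (rule partial_deriv_cong[OF assms(1) _ assms(3)])

lemma C_k_on_open_has_derivative:
  assumes "C_k_on (Suc k) f S" "open S" "x \<in> S"
  shows "(f has_derivative (\<lambda>h. partial_deriv h f x)) (at x)"
  using C_k_on_has_derivative[OF assms(1,3)] assms(2,3) by (simp add: partial_deriv_def at_within_open[of _ S])

lemma C_k_on_partial_deriv:
  assumes "open S" "C_k_on (Suc k) f S" "e \<in> Basis" shows "C_k_on k (partial_deriv e f) S"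
proof -
  have "C_k_on k (\<lambda>x. frechet_derivative f (at x within S) e) S" using assms by simp
  also have "?this \<longleftrightarrow> ?thesis"
    using assms(1) by (intro C_k_on_cong) (simp add: partial_deriv_def at_within_open[of _ S])
  finally show ?thesis .
qed

lemma C_k_on_laplacian:
  assumes "open S" "C_k_on (Suc (Suc k)) f S" shows "C_k_on k (laplacian f) S"
  unfolding laplacian_def
  by (intro C_k_on_sum unique_derivs_open C_k_on_partial_deriv finite_Basis assms)

lemma laplacian_radial:
  fixes x :: "'a::euclidean_space" and W W1 W2 :: "real \<Rightarrow> real"
  assumes S: "open S" "x \<in> S" "\<And>x. x \<in> S \<Longrightarrow> x \<bullet> x \<in> T"
    and W: "\<And>s. s \<in> T \<Longrightarrow> (W has_real_derivative W1 s) (at s within T)"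
    and W1: "\<And>s. s \<in> T \<Longrightarrow> (W1 has_real_derivative W2 s) (at s within T)"
  shows "laplacian (\<lambda>x. W (x \<bullet> x)) x = 4 * (x \<bullet> x) * W2 (x \<bullet> x) + 2 * DIM('a) * W1 (x \<bullet> x)"
proof -
  have p: "partial_deriv e (\<lambda>x. W (x \<bullet> x)) y = W1 (y \<bullet> y) * (2 * (y \<bullet> e))" if "y \<in> S" for y e
    by (rule partial_deriv_eq[OF has_derivative_radial_open[OF S(1) that S(3) W]])
  have q: "partial_deriv e (partial_deriv e (\<lambda>x. W (x \<bullet> x))) x =
      4 * W2 (x \<bullet> x) * (x \<bullet> e)\<^sup>2 + 2 * W1 (x \<bullet> x)" if "e \<in> Basis" for e
  proof -
    have "partial_deriv e (partial_deriv e (\<lambda>x. W (x \<bullet> x))) x = partial_deriv e (\<lambda>y. W1 (y \<bullet> y) * (2 * (y \<bullet> e))) x"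
      using p S by (intro partial_deriv_cong[of S]) auto
    also have "\<dots> = W1 (x \<bullet> x) * (2 * (e \<bullet> e)) + W2 (x \<bullet> x) * (2 * (x \<bullet> e)) * (2 * (x \<bullet> e))"
    proof (rule partial_deriv_eq[where D="\<lambda>h. W1 (x \<bullet> x) * (2 * (h \<bullet> e)) + W2 (x \<bullet> x) * (2 * (x \<bullet> h)) * (2 * (x \<bullet> e))"])
      have "((\<lambda>y. W1 (y \<bullet> y)) has_derivative (\<lambda>h. W2 (x \<bullet> x) * (2 * (x \<bullet> h)))) (at x)"
        by (rule has_derivative_radial_open[OF S W1])
      then show "((\<lambda>y. W1 (y \<bullet> y) * (2 * (y \<bullet> e))) has_derivative
          (\<lambda>h. W1 (x \<bullet> x) * (2 * (h \<bullet> e)) + W2 (x \<bullet> x) * (2 * (x \<bullet> h)) * (2 * (x \<bullet> e)))) (at x)"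
        by (rule has_derivative_mult) (auto intro!: derivative_eq_intros)
    qed
    finally show ?thesis using that by (simp add: power2_eq_square algebra_simps inner_Basis)
  qed
  have "(\<Sum>e\<in>Basis. (x \<bullet> e)\<^sup>2) = x \<bullet> x"
    by (simp add: euclidean_inner[of x x] power2_eq_square)
  then show ?thesis
    by (simp add: laplacian_def q sum.distrib flip: sum_distrib_left)
qed

text \<open>A self-adjoint involution is orthogonal. The second derivatives of f o Q are the Hessian
  of f contracted twice with the matrix of Q; summing over e turns the two matrix factors into a
  Kronecker delta, which leaves the trace.\<close>

lemma laplacian_compose_isometry:
  fixes Q :: "'a::euclidean_space \<Rightarrow> 'a"
  assumes S: "open S" "\<And>x. x \<in> S \<Longrightarrow> Q x \<in> S" "x \<in> S" and f: "C_k_on (Suc (Suc 0)) f S"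
    and Q: "bounded_linear Q" "\<And>x y. Q x \<bullet> y = x \<bullet> Q y" "\<And>x. Q (Q x) = x"
  shows "laplacian (\<lambda>x. f (Q x)) x = laplacian f (Q x)"
proof -
  have p: "partial_deriv e (\<lambda>x. g (Q x)) y = (\<Sum>b\<in>Basis. (Q e \<bullet> b) * partial_deriv b g (Q y))"
    if y: "y \<in> S" and g: "C_k_on (Suc 0) g S" for y e g
  proof -
    have d: "(g has_derivative (\<lambda>h. partial_deriv h g (Q y))) (at (Q y))"
      using C_k_on_open_has_derivative[OF g S(1)] S(2) y by blast
    interpret D: bounded_linear "\<lambda>h. partial_deriv h g (Q y)" using d by (rule has_derivative_bounded_linear)
    have "((\<lambda>x. g (Q x)) has_derivative (\<lambda>h. partial_deriv (Q h) g (Q y))) (at y)"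
      by (rule has_derivative_compose[OF bounded_linear_imp_has_derivative[OF Q(1)] d])
    then have "partial_deriv e (\<lambda>x. g (Q x)) y = partial_deriv (\<Sum>b\<in>Basis. (Q e \<bullet> b) *\<^sub>R b) g (Q y)"
      by (simp add: partial_deriv_eq euclidean_representation)
    then show ?thesis by (simp add: D.sum D.scaleR)
  qed
  have pf: "C_k_on (Suc 0) (partial_deriv b f) S" if "b \<in> Basis" for b
    using C_k_on_partial_deriv[OF S(1) f that] .
  have q: "partial_deriv e (partial_deriv e (\<lambda>x. f (Q x))) x =
      (\<Sum>b\<in>Basis. \<Sum>c\<in>Basis. (Q e \<bullet> b) * (Q e \<bullet> c) * partial_deriv c (partial_deriv b f) (Q x))" for e
  proof -
    have "partial_deriv e (partial_deriv e (\<lambda>x. f (Q x))) x =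
        partial_deriv e (\<lambda>y. (\<lambda>z. \<Sum>b\<in>Basis. (Q e \<bullet> b) * partial_deriv b f z) (Q y)) x"
      using p[OF _ C_k_on_SucD[OF f]] S by (intro partial_deriv_cong[of S]) auto
    also have "\<dots> = (\<Sum>c\<in>Basis. (Q e \<bullet> c) * partial_deriv c (\<lambda>z. \<Sum>b\<in>Basis. (Q e \<bullet> b) * partial_deriv b f z) (Q x))"
      using S pf by (intro p C_k_on_sum C_k_on_mult C_k_on_const unique_derivs_open) auto
    also have "\<dots> = (\<Sum>c\<in>Basis. (Q e \<bullet> c) * (\<Sum>b\<in>Basis. (Q e \<bullet> b) * partial_deriv c (partial_deriv b f) (Q x)))"
    proof (intro sum.cong refl arg_cong[where f="\<lambda>z. _ * z"])
      fix c :: 'a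
      have "(partial_deriv b f has_derivative (\<lambda>h. partial_deriv h (partial_deriv b f) (Q x))) (at (Q x))"
        if "b \<in> Basis" for b
        using C_k_on_open_has_derivative[OF pf[OF that] S(1)] S by blast
      then have "((\<lambda>z. \<Sum>b\<in>Basis. (Q e \<bullet> b) * partial_deriv b f z) has_derivative
          (\<lambda>h. \<Sum>b\<in>Basis. (Q e \<bullet> b) * partial_deriv h (partial_deriv b f) (Q x))) (at (Q x))"
        by (intro has_derivative_sum has_derivative_mult_right) auto
      then show "partial_deriv c (\<lambda>z. \<Sum>b\<in>Basis. (Q e \<bullet> b) * partial_deriv b f z) (Q x) =
          (\<Sum>b\<in>Basis. (Q e \<bullet> b) * partial_deriv c (partial_deriv b f) (Q x))"
        by (simp add: partial_deriv_eq)
    qed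
    finally show ?thesis
      by (subst sum.swap) (simp add: sum_distrib_left mult_ac)
  qed
  have orth: "(\<Sum>e\<in>Basis. (Q e \<bullet> b) * (Q e \<bullet> c)) = (if b = c then 1 else 0)"
    if "b \<in> Basis" "c \<in> Basis" for b c
  proof -
    have "(\<Sum>e\<in>Basis. (Q e \<bullet> b) * (Q e \<bullet> c)) = Q b \<bullet> Q c"
      unfolding euclidean_inner[of "Q b" "Q c"] by (metis Q(2) inner_commute)
    also have "\<dots> = b \<bullet> c" unfolding Q(2) Q(3) ..
    finally show ?thesis using that by (simp add: inner_Basis)
  qed
  have "laplacian (\<lambda>x. f (Q x)) x = (\<Sum>b\<in>Basis. \<Sum>c\<in>Basis.
      (\<Sum>e\<in>Basis. (Q e \<bullet> b) * (Q e \<bullet> c)) * partial_deriv c (partial_deriv b f) (Q x))"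
    unfolding laplacian_def q
    by (subst sum.swap, rule sum.cong[OF refl], subst sum.swap) (simp add: sum_distrib_right)
  also have "\<dots> = laplacian f (Q x)"
    by (simp add: orth laplacian_def if_distrib[of "\<lambda>z. z * _"] cong: if_cong)
  finally show ?thesis .
qed

section \<open>Boundedness of the admissible parameters\<close>

lemma integrable_compact_support:
  fixes f :: "'a::euclidean_space \<Rightarrow> real"
  assumes "continuous_on UNIV f" "\<And>x. r < norm x \<Longrightarrow> f x = 0"
  shows "integrable lborel f"
proof -
  have "integrable lborel (\<lambda>x. indicator (cball 0 r) x *\<^sub>R f x)"
    by (rule borel_integrable_compact) (auto intro: continuous_on_subset[OF assms(1)])
  also have "(\<lambda>x. indicator (cball 0 r) x *\<^sub>R f x) = f"
    using assms(2) by (auto simp: fun_eq_iff indicator_def not_le)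
  finally show ?thesis .
qed

text \<open>Difference quotients of F have integral zero by translation invariance of Lebesgue
  measure and converge boundedly to the directional derivative; dominated convergence takes the
  place of Fubini or the divergence theorem.\<close>

lemma integral_partial_deriv_compact_support:
  fixes F :: "'a::euclidean_space \<Rightarrow> real"
  assumes F: "\<And>x. (F has_derivative D x) (at x)" and cont: "continuous_on UNIV (\<lambda>x. D x e)"
    and supp: "\<And>x. r < norm x \<Longrightarrow> F x = 0" "\<And>x. r < norm x \<Longrightarrow> D x e = 0" and e: "norm e = 1"
  shows "integral\<^sup>L lborel (\<lambda>x. D x e) = 0"
proof -
  have contF: "continuous_on UNIV F"
    using F has_derivative_continuous by (blast intro: continuous_at_imp_continuous_on)
  \<comment> \<open>Increments of at most 1 keep all difference quotients supported in the ball of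
    radius r + 1, on which they are dominated by the constant M.\<close>
  define t :: "nat \<Rightarrow> real" where "t n = inverse (real (Suc n))" for n
  have t: "0 < t n" "t n \<le> 1" for n by (simp_all add: t_def divide_simps)
  have t0: "t \<longlonglongrightarrow> 0" unfolding t_def by (rule LIMSEQ_inverse_real_of_nat)
  obtain M where M: "\<And>x. norm x \<le> r \<Longrightarrow> \<bar>D x e\<bar> \<le> M" and M0: "0 \<le> M"
  proof -
    have "bounded ((\<lambda>x. D x e) ` cball 0 r)"
      by (intro compact_imp_bounded compact_continuous_image continuous_on_subset[OF cont]) auto
    then obtain M where "\<forall>x\<in>cball 0 r. \<bar>D x e\<bar> \<le> M" by (auto simp: bounded_iff)
    then show ?thesis by (intro that[of "max M 0"]) (auto intro: max.coboundedI1)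
  qed
  have M: "\<bar>D x e\<bar> \<le> M" for x using M[of x] M0 supp(2)[of x] by (cases "norm x \<le> r") auto
  have line: "((\<lambda>s. F (x + s *\<^sub>R e)) has_real_derivative D (x + s *\<^sub>R e) e) (at s)" for x s
  proof -
    interpret D: bounded_linear "D (x + s *\<^sub>R e)" using F by (rule has_derivative_bounded_linear)
    have "((\<lambda>s. x + s *\<^sub>R e) has_derivative (\<lambda>h. h *\<^sub>R e)) (at s)"
      by (auto intro!: derivative_eq_intros)
    from has_derivative_compose[OF this F] show ?thesis
      by (simp add: has_field_derivative_def D.scaleR mult.commute[of _ "D _ e"])
  qed
  define q where "q n x = (F (x + t n *\<^sub>R e) - F x) / t n" for n x
  have "(\<lambda>n. integral\<^sup>L lborel (q n)) \<longlonglongrightarrow> integral\<^sup>L lborel (\<lambda>x. D x e)"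
  proof (rule integral_dominated_convergence[where w="\<lambda>x. M * indicator (cball 0 (r + 1)) x"])
    show "(\<lambda>x. D x e) \<in> borel_measurable lborel"
      using cont by (simp add: borel_measurable_continuous_onI)
    show "q n \<in> borel_measurable lborel" for n
      unfolding q_def using t[of n]
      by (auto intro!: borel_measurable_continuous_onI continuous_intros continuous_on_compose2[OF contF])
    show "integrable lborel (\<lambda>x::'a. M * indicator (cball 0 (r + 1)) x)"
      by (intro integrable_mult_right integrable_real_indicator) (simp_all add: emeasure_lborel_cball_finite[unfolded infinity_ennreal_def])
    show "AE x in lborel. (\<lambda>n. q n x) \<longlonglongrightarrow> D x e"
    proof (rule AE_I2)
      fix x
      have "((\<lambda>h. (F (x + h *\<^sub>R e) - F x) / h) \<longlongrightarrow> D x e) (at 0)"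
        using line[of x 0] by (simp add: DERIV_def)
      moreover have "filterlim t (at 0) sequentially"
        using t by (intro filterlim_atI t0) (auto simp: less_imp_neq[symmetric])
      ultimately show "(\<lambda>n. q n x) \<longlonglongrightarrow> D x e"
        unfolding q_def by (rule filterlim_compose)
    qed
    show "AE x in lborel. norm (q n x) \<le> M * indicator (cball 0 (r + 1)) x" for n
    proof (rule AE_I2)
      fix x
      show "norm (q n x) \<le> M * indicator (cball 0 (r + 1)) x"
      proof (cases "norm x \<le> r + 1")
        case True
        obtain z where "F (x + t n *\<^sub>R e) - F (x + 0 *\<^sub>R e) = (t n - 0) * D (x + z *\<^sub>R e) e"
          using MVT2[of 0 "t n" "\<lambda>s. F (x + s *\<^sub>R e)" "\<lambda>s. D (x + s *\<^sub>R e) e"] line t by blast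
        with M t[of n] True show ?thesis by (simp add: q_def)
      next
        case False
        have "norm x \<le> norm (x + t n *\<^sub>R e) + norm (t n *\<^sub>R e)"
          using norm_triangle_ineq4[of "x + t n *\<^sub>R e" "t n *\<^sub>R e"] by simp
        with False t[of n] e have "r < norm (x + t n *\<^sub>R e)" by simp
        with False supp(1) show ?thesis by (simp add: q_def)
      qed
    qed
  qed
  moreover have "integral\<^sup>L lborel (q n) = 0" for n
  proof -
    have F1: "integrable lborel F" using integrable_compact_support[OF contF supp(1)] .
    have plus: "distr lborel borel ((+) (t n *\<^sub>R e)) = lborel"
      using lborel_affine[of 1 "t n *\<^sub>R e"] by (simp add: density_1)
    have "integral\<^sup>L lborel F = integral\<^sup>L (distr lborel borel ((+) (t n *\<^sub>R e))) F"
      by (simp add: plus)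
    also have "\<dots> = integral\<^sup>L lborel (\<lambda>x. F (t n *\<^sub>R e + x))"
      using F1 by (intro integral_distr) auto
    finally have eq: "integral\<^sup>L lborel (\<lambda>x. F (x + t n *\<^sub>R e)) = integral\<^sup>L lborel F"
      by (simp add: add.commute)
    have "integrable (distr lborel borel ((+) (t n *\<^sub>R e))) F" using F1 by (simp add: plus)
    then have F2: "integrable lborel (\<lambda>x. F (x + t n *\<^sub>R e))"
      by (subst (asm) integrable_distr_eq) (use F1 in \<open>auto simp: add.commute\<close>)
    show ?thesis unfolding q_def using eq F1 F2 by simp
  qed
  ultimately show ?thesis by (simp add: LIMSEQ_const_iff)
qed

text \<open>Outside the ball w is arbitrary. The product is continuous on the unit ball and vanishes
  off the ball of radius r; these two open sets cover the space because r < 1.\<close>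

lemma continuous_cutoff_product:
  fixes w :: "'a::euclidean_space \<Rightarrow> real"
  assumes "continuous_on UNIV f" "\<And>x. r < norm x \<Longrightarrow> f x = 0" "r < 1" "continuous_on (ball 0 1) w"
  shows "continuous_on UNIV (\<lambda>x. f x * w x)"
proof -
  have "continuous_on (- cball 0 r) (\<lambda>x. f x * w x)"
    using assms(2) by (subst continuous_on_cong[OF refl, of _ _ "\<lambda>_. 0"]) auto
  moreover have "continuous_on (ball 0 1) (\<lambda>x. f x * w x)"
    by (intro continuous_intros assms(4) continuous_on_subset[OF assms(1)]) auto
  ultimately have "continuous_on (- cball 0 r \<union> ball 0 1) (\<lambda>x. f x * w x)"
    by (intro continuous_on_open_Un) auto
  also have "- cball 0 r \<union> ball 0 1 = (UNIV :: 'a set)" using assms(3) by auto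
  finally show ?thesis .
qed

lemma partial_deriv_zero_outside:
  assumes "\<And>x. r < norm x \<Longrightarrow> f x = 0" "r < norm x" shows "partial_deriv e f x = 0"
proof -
  have "partial_deriv e f x = partial_deriv e (\<lambda>x. 0) x"
    using assms by (intro partial_deriv_cong[of "- cball 0 r"]) auto
  also have "\<dots> = 0" by (rule partial_deriv_eq[OF has_derivative_const])
  finally show ?thesis .
qed

lemma integral_by_parts_cutoff:
  fixes f w :: "'a::euclidean_space \<Rightarrow> real"
  assumes f: "C_k_on 1 f UNIV" "\<And>x. r < norm x \<Longrightarrow> f x = 0" and r: "r < 1"
    and w: "C_k_on 1 w (ball 0 1)" and e: "e \<in> Basis"
  shows "integral\<^sup>L lborel (\<lambda>x. f x * partial_deriv e w x) = - integral\<^sup>L lborel (\<lambda>x. partial_deriv e f x * w x)"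
    "integrable lborel (\<lambda>x. f x * partial_deriv e w x)" "integrable lborel (\<lambda>x. partial_deriv e f x * w x)"
proof -
  note f1 = f(1)[unfolded One_nat_def] and w1 = w[unfolded One_nat_def]
  have c: "continuous_on UNIV f" "continuous_on (ball 0 1) w" "continuous_on UNIV (partial_deriv e f)"
    "continuous_on (ball 0 1) (partial_deriv e w)"
    using C_k_on_SucD[OF f1] C_k_on_SucD[OF w1] C_k_on_partial_deriv[OF _ f1 e] C_k_on_partial_deriv[OF _ w1 e]
    by simp_all
  have z: "partial_deriv e f x = 0" if "r < norm x" for x e
    using that by (intro partial_deriv_zero_outside[of r f] f(2))
  have c1: "continuous_on UNIV (\<lambda>x. f x * partial_deriv e w x)" "continuous_on UNIV (\<lambda>x. partial_deriv e f x * w x)"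
    by (intro continuous_cutoff_product[of _ r] c f(2) z r; assumption)+
  show i1: "integrable lborel (\<lambda>x. f x * partial_deriv e w x)" and i2: "integrable lborel (\<lambda>x. partial_deriv e f x * w x)"
    using integrable_compact_support[OF c1(1), of r] integrable_compact_support[OF c1(2), of r] f(2) z by simp_all
  \<comment> \<open>The derivatives of w are arbitrary beyond the unit ball, so the derivative of
    the product is set to 0 where f vanishes anyway.\<close>
  define D where "D x h = (if r < norm x then 0 else f x * partial_deriv h w x + partial_deriv h f x * w x)" for x h
  have D: "((\<lambda>x. f x * w x) has_derivative D x) (at x)" for x
  proof (cases "r < norm x")
    case True
    have "((\<lambda>x. 0) has_derivative D x) (at x)" using True by (simp add: D_def[abs_def])
    then show ?thesis
      by (rule has_derivative_transform_within_open[of _ _ _ _ "- cball 0 r"]) (use True f(2) in auto)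
  next
    case False
    then have x: "x \<in> ball 0 1" using r by auto
    have "((\<lambda>x. f x * w x) has_derivative (\<lambda>h. f x * partial_deriv h w x + partial_deriv h f x * w x)) (at x)"
      by (intro has_derivative_mult C_k_on_open_has_derivative[OF f1] C_k_on_open_has_derivative[OF w1] x) auto
    then show ?thesis using False by (simp add: D_def[abs_def])
  qed
  have De: "D x e = f x * partial_deriv e w x + partial_deriv e f x * w x" for x
    using f(2)[of x] z[of x] by (simp add: D_def)
  have "integral\<^sup>L lborel (\<lambda>x. D x e) = 0"
  proof (rule integral_partial_deriv_compact_support[OF D])
    show "continuous_on UNIV (\<lambda>x. D x e)" unfolding De by (intro continuous_intros c1)
  qed (use f(2) e in \<open>auto simp: D_def\<close>)
  then show "integral\<^sup>L lborel (\<lambda>x. f x * partial_deriv e w x) = - integral\<^sup>L lborel (\<lambda>x. partial_deriv e f x * w x)"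
    unfolding De using i1 i2 by simp
qed

lemma integral_laplacian_cutoff:
  fixes f w :: "'a::euclidean_space \<Rightarrow> real"
  assumes f: "C_k_on 2 f UNIV" "\<And>x. r < norm x \<Longrightarrow> f x = 0" and r: "r < 1" and w: "C_k_on 2 w (ball 0 1)"
  shows "integral\<^sup>L lborel (\<lambda>x. f x * laplacian w x) = integral\<^sup>L lborel (\<lambda>x. laplacian f x * w x)"
proof -
  note f1 = f(1)[unfolded numeral_2_eq_2] and w1 = w[unfolded numeral_2_eq_2]
  have C: "C_k_on 1 f UNIV" "C_k_on 1 w (ball 0 1)"
    "e \<in> Basis \<Longrightarrow> C_k_on 1 (partial_deriv e f) UNIV" "e \<in> Basis \<Longrightarrow> C_k_on 1 (partial_deriv e w) (ball 0 1)" for e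
    using C_k_on_SucD[OF f1] C_k_on_SucD[OF w1] C_k_on_partial_deriv[OF _ f1] C_k_on_partial_deriv[OF _ w1] by simp_all
  have z: "partial_deriv e f x = 0" if "r < norm x" for x e
    using that by (intro partial_deriv_zero_outside[of r f] f(2))
  have i: "integrable lborel (\<lambda>x. f x * partial_deriv e (partial_deriv e w) x)"
    "integrable lborel (\<lambda>x. partial_deriv e (partial_deriv e f) x * w x)"
    "integral\<^sup>L lborel (\<lambda>x. f x * partial_deriv e (partial_deriv e w) x) =
     integral\<^sup>L lborel (\<lambda>x. partial_deriv e (partial_deriv e f) x * w x)" if e: "e \<in> Basis" for e
    using integral_by_parts_cutoff[where f=f and r=r, OF C(1) f(2) r C(4)[OF e] e]
      integral_by_parts_cutoff[where f="partial_deriv e f" and r=r, OF C(3)[OF e] z r C(2) e]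
    by simp_all
  show ?thesis
    unfolding laplacian_def sum_distrib_left sum_distrib_right using i by (simp add: integral_sum)
qed

section \<open>A bump function and the bound on the parameter\<close>

lemma has_real_derivative_pos_part_power:
  "((\<lambda>s::real. (max 0 (a - s)) ^ Suc (Suc n)) has_real_derivative - real (Suc (Suc n)) * (max 0 (a - s)) ^ Suc n) (at s)"
proof (cases s a rule: linorder_cases)
  case less
  have "((\<lambda>s. (a - s) ^ Suc (Suc n)) has_real_derivative - real (Suc (Suc n)) * (a - s) ^ Suc n) (at s)"
    by (rule derivative_eq_intros refl)+ (simp add: algebra_simps)
  then have "((\<lambda>s. (max 0 (a - s)) ^ Suc (Suc n)) has_real_derivative - real (Suc (Suc n)) * (a - s) ^ Suc n) (at s)"
    by (rule has_field_derivative_transform_within_open[of _ _ _ "{..<a}"]) (use less in auto)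
  then show ?thesis using less by (simp add: max_def)
next
  case greater
  have "((\<lambda>s. 0) has_real_derivative 0) (at s)" by simp
  then have "((\<lambda>s. (max 0 (a - s)) ^ Suc (Suc n)) has_real_derivative 0) (at s)"
    by (rule has_field_derivative_transform_within_open[of _ _ _ "{a<..}"]) (use greater in auto)
  then show ?thesis using greater by (simp add: max_def)
next
  case equal
  have L: "((\<lambda>h::real. \<bar>h\<bar> ^ Suc n) \<longlongrightarrow> 0) (at 0)"
    by (rule tendsto_eq_intros refl | simp)+
  have "((\<lambda>h::real. (max 0 (- h)) ^ Suc (Suc n) / h) \<longlongrightarrow> 0) (at 0)"
  proof (rule Lim_null_comparison[OF _ L])
    show "\<forall>\<^sub>F h in at 0. norm ((max 0 (- h)) ^ Suc (Suc n) / h) \<le> \<bar>h\<bar> ^ Suc n"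
    proof (rule always_eventually, rule allI)
      fix h :: real
      have "\<bar>max 0 (- h)\<bar> ^ Suc (Suc n) \<le> \<bar>h\<bar> ^ Suc (Suc n)" by (intro power_mono) auto
      then have "\<bar>max 0 (- h)\<bar> ^ Suc (Suc n) / \<bar>h\<bar> \<le> \<bar>h\<bar> ^ Suc (Suc n) / \<bar>h\<bar>"
        by (intro divide_right_mono) auto
      also have "\<dots> = \<bar>h\<bar> ^ Suc n" by (cases "h = 0") simp_all
      finally show "norm ((max 0 (- h)) ^ Suc (Suc n) / h) \<le> \<bar>h\<bar> ^ Suc n"
        by (simp only: real_norm_def abs_divide power_abs)
    qed
  qed
  then show ?thesis using equal by (simp add: DERIV_def)
qed

text \<open>The fifth power of the positive part of 1/4 - |x|^2. The j-th derivative in s = |x|^2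
  carries the power 5 - j, which is still continuous for j = 4.\<close>

lemma exists_test_function:
  obtains f :: "'a::euclidean_space \<Rightarrow> real" where "C_k_on 4 f UNIV" "\<And>x. 1/2 < norm x \<Longrightarrow> f x = 0"
    "\<And>x. 0 \<le> f x" "0 < integral\<^sup>L lborel f"
proof
  define W where "W j s = (-1) ^ j * (\<Prod>i<j. real (5 - i)) * (max 0 (1/4 - s)) ^ (5 - j)" for j and s :: real
  let ?f = "\<lambda>x::'a. W 0 (x \<bullet> x)"
  have W: "(W j has_real_derivative W (Suc j) s) (at s)" if j: "j < 4" for j s
  proof -
    define n where "n = 3 - j"
    have n: "5 - j = Suc (Suc n)" using j by (simp add: n_def)
    then have n': "5 - Suc j = Suc n" by simp
    show ?thesis
      unfolding W_def n n'
      by (rule DERIV_cong[OF DERIV_cmult[OF has_real_derivative_pos_part_power]]) (simp add: n algebra_simps)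
  qed
  show C: "C_k_on 4 ?f UNIV"
  proof (rule C_k_on_radial[where T=UNIV])
    show "continuous_on UNIV (W 4)" unfolding W_def by (intro continuous_intros)
  qed (use W in \<open>auto intro: unique_derivs_open\<close>)
  show z: "?f x = 0" if "1/2 < norm x" for x
  proof -
    have "(1/2)^2 < (norm x)^2" using that by (intro power_strict_mono) auto
    then show ?thesis by (simp add: W_def dot_square_norm power2_eq_square)
  qed
  show nn: "0 \<le> ?f x" for x by (simp add: W_def)
  have int: "integrable lborel ?f"
    using C_k_on_le[OF C, of 0] by (intro integrable_compact_support[of _ "1/2"] z) auto
  \<comment> \<open>For |x| < 1/4 the base 1/4 - |x|^2 is at least 1/4 - 1/16 = 3/16.\<close>
  have "0 < (3/16)^5 * measure lborel (ball (0::'a) (1/4))"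
    by (intro mult_pos_pos content_ball_pos) auto
  also have "\<dots> = integral\<^sup>L lborel (\<lambda>x. (3/16)^5 * indicator (ball (0::'a) (1/4)) x)"
    by simp
  also have "\<dots> \<le> integral\<^sup>L lborel ?f"
  proof (rule integral_mono[OF _ int])
    show "integrable lborel (\<lambda>x. (3/16)^5 * indicator (ball (0::'a) (1/4)) x :: real)"
      by (intro integrable_mult_right integrable_real_indicator) (simp_all add: emeasure_lborel_ball_finite[unfolded infinity_ennreal_def])
    show "(3/16)^5 * indicator (ball 0 (1/4)) x \<le> ?f x" for x
    proof (cases "norm x < 1/4")
      case True
      then have "(norm x)^2 \<le> (1/4)^2" by (intro power_mono) auto
      then have "x \<bullet> x \<le> 1/16" by (simp add: dot_square_norm power2_eq_square)
      then show ?thesis using True by (simp add: W_def)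
    qed (use nn in simp)
  qed
  finally show "0 < integral\<^sup>L lborel ?f" .
qed

text \<open>Because 0 < 1 - u < 1, the right-hand side of the equation is at least l. Moving both
  Laplacians onto the bump function f and using 0 < u < 1 again bounds l by a quotient that depends
  on f alone; the support of f keeps the boundary behaviour of u out of the estimate.\<close>

lemma classical_solution_bounded:
  obtains M where "\<And>l (u :: 'a::euclidean_space \<Rightarrow> real). 0 < l \<Longrightarrow> classical_solution l u \<Longrightarrow> l \<le> M"
proof -
  obtain f :: "'a \<Rightarrow> real" where f: "C_k_on 4 f UNIV" "\<And>x. 1/2 < norm x \<Longrightarrow> f x = 0" "\<And>x. 0 \<le> f x" "0 < integral\<^sup>L lborel f"
    by (rule exists_test_function) blast
  let ?I = "integral\<^sup>L lborel (\<lambda>x. \<bar>laplacian (laplacian f) x\<bar>)"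
  have f2: "C_k_on 2 f UNIV" using C_k_on_le[OF f(1), of 2] by simp
  have "C_k_on (Suc (Suc 2)) f UNIV" using f(1) by (simp add: numeral_eq_Suc)
  then have lf: "C_k_on 2 (laplacian f) UNIV" by (intro C_k_on_laplacian) auto
  then have llf: "continuous_on UNIV (laplacian (laplacian f))"
    using C_k_on_laplacian[of UNIV 0 "laplacian f"] by (simp add: numeral_2_eq_2 del: C_k_on.simps(2))
  have zf: "laplacian f x = 0" if "1/2 < norm x" for x
    unfolding laplacian_def using that by (intro sum.neutral ballI partial_deriv_zero_outside[of "1/2"] f(2)) auto
  have zzf: "laplacian (laplacian f) x = 0" if "1/2 < norm x" for x
    unfolding laplacian_def[of "laplacian f"] using that
    by (intro sum.neutral ballI partial_deriv_zero_outside[of "1/2"] zf) auto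
  have "l \<le> ?I / integral\<^sup>L lborel f" if l: "0 < l" and u: "classical_solution l u" for l and u :: "'a \<Rightarrow> real"
  proof -
    have C: "C_k_on 4 u (ball 0 1)" and eq: "\<And>x. x \<in> ball 0 1 \<Longrightarrow> laplacian (laplacian u) x = l / (1 - u x)\<^sup>2"
      and b: "\<And>x. x \<in> ball 0 1 \<Longrightarrow> 0 < u x \<and> u x < 1"
      using u by (auto simp: classical_solution_def)
    have u2: "C_k_on 2 u (ball 0 1)" using C_k_on_le[OF C, of 2] by simp
    have "C_k_on (Suc (Suc 2)) u (ball 0 1)" using C by (simp add: numeral_eq_Suc)
    then have lu: "C_k_on 2 (laplacian u) (ball 0 1)" by (intro C_k_on_laplacian) auto
    then have llu: "continuous_on (ball 0 1) (laplacian (laplacian u))"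
      using C_k_on_laplacian[of "ball 0 1" 0 "laplacian u"] by (simp add: numeral_2_eq_2 del: C_k_on.simps(2))
    have cf: "continuous_on UNIV f" and cu: "continuous_on (ball 0 1) u"
      using C_k_on_le[OF f(1), of 0] C_k_on_le[OF C, of 0] by simp_all
    have if': "integrable lborel f" using integrable_compact_support[of f "1/2", OF cf f(2)] .
    have "l * integral\<^sup>L lborel f = integral\<^sup>L lborel (\<lambda>x. l * f x)" by simp
    also have "\<dots> \<le> integral\<^sup>L lborel (\<lambda>x. f x * laplacian (laplacian u) x)"
    proof (rule integral_mono)
      show "integrable lborel (\<lambda>x. f x * laplacian (laplacian u) x)"
        by (rule integrable_compact_support[OF continuous_cutoff_product[where r="1/2" and f=f, OF cf f(2) _ llu], of "1/2"]) (auto simp: f(2))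
      show "l * f x \<le> f x * laplacian (laplacian u) x" for x
      proof (cases "norm x < 1")
        case True
        then have x: "x \<in> ball 0 1" by simp
        have "l * (1 - u x)\<^sup>2 \<le> l * 1"
          using l b[OF x] by (intro mult_left_mono power_le_one) auto
        then have "l \<le> laplacian (laplacian u) x"
          using b[OF x] by (simp add: eq[OF x] pos_le_divide_eq)
        then show ?thesis using mult_right_mono[OF _ f(3)[of x]] by (simp add: mult.commute[of "f x"])
      qed (simp add: f(2))
    qed (use if' in simp)
    also have "\<dots> = integral\<^sup>L lborel (\<lambda>x. laplacian f x * laplacian u x)"
      by (rule integral_laplacian_cutoff[where r="1/2" and f=f, OF f2 f(2) _ lu]) auto
    also have "\<dots> = integral\<^sup>L lborel (\<lambda>x. laplacian (laplacian f) x * u x)"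
      by (rule integral_laplacian_cutoff[where r="1/2" and f="laplacian f", OF lf zf _ u2]) auto
    also have "\<dots> \<le> ?I"
    proof (rule integral_mono)
      show "integrable lborel (\<lambda>x. laplacian (laplacian f) x * u x)"
        by (rule integrable_compact_support[OF continuous_cutoff_product[where r="1/2", OF llf zzf _ cu], of "1/2"]) (auto simp: zzf)
      show "integrable lborel (\<lambda>x. \<bar>laplacian (laplacian f) x\<bar>)"
        by (rule integrable_compact_support[of _ "1/2"]) (auto intro!: continuous_intros llf simp: zzf)
      show "laplacian (laplacian f) x * u x \<le> \<bar>laplacian (laplacian f) x\<bar>" for x
      proof (cases "norm x < 1")
        case True
        then have "\<bar>laplacian (laplacian f) x * u x\<bar> \<le> \<bar>laplacian (laplacian f) x\<bar> * 1"
          using b[of x] unfolding abs_mult by (intro mult_left_mono) auto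
        then show ?thesis by linarith
      qed (simp add: zzf)
    qed
    finally show ?thesis using f(4) by (simp add: pos_le_divide_eq)
  qed
  then show ?thesis using that by blast
qed

section \<open>Radial solutions of the Dirichlet problem\<close>

text \<open>Radial functions are written as functions of \<open>s = |x|\<^sup>2\<close>, in which the Laplacian of \<open>W(|x|\<^sup>2)\<close> is
  \<open>4 s W'' + 2 N W'\<close>; with \<open>p = N/2\<close>, this equals \<open>F\<close> for \<open>W'(s) = 1/4 \<integral> t powr (p - 1) * F (s t) dt\<close> over \<open>[0, 1]\<close>.\<close>

definition radial_mean :: "real \<Rightarrow> (real \<Rightarrow> real) \<Rightarrow> real \<Rightarrow> real" where
  "radial_mean a F s = integral {0..1} (\<lambda>t. t powr a * F (s * t))"

definition radial_inverse_laplacian :: "real \<Rightarrow> (real \<Rightarrow> real) \<Rightarrow> real \<Rightarrow> real" where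
  "radial_inverse_laplacian p F s = integral {0..s} (\<lambda>\<sigma>. radial_mean (p - 1) F \<sigma> / 4)"

text \<open>\<open>dirichlet_laplacian p f\<close> is the Laplacian of \<open>dirichlet_green p f\<close>; its additive constant is fixed
  by the Neumann condition at \<open>s = 1\<close>.\<close>

definition dirichlet_laplacian :: "real \<Rightarrow> (real \<Rightarrow> real) \<Rightarrow> real \<Rightarrow> real" where
  "dirichlet_laplacian p f s = radial_inverse_laplacian p f s - p * radial_mean (p - 1) (radial_inverse_laplacian p f) 1"

definition dirichlet_green :: "real \<Rightarrow> (real \<Rightarrow> real) \<Rightarrow> real \<Rightarrow> real" where
  "dirichlet_green p f s = radial_inverse_laplacian p (dirichlet_laplacian p f) s
     - radial_inverse_laplacian p (dirichlet_laplacian p f) 1"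

text \<open>A positive exponent gives continuity at t = 0, where \<open>0 powr a\<close> is 0. For
  the exponent p - 1 with p = N/2 this is the condition N > 2.\<close>

lemma continuous_on_powr_const: "0 < a \<Longrightarrow> continuous_on {0..1} (\<lambda>t::real. t powr a)"
  by (intro continuous_on_powr' continuous_intros) auto

lemma continuous_on_mean_integrand:
  fixes a :: real and F :: "real \<Rightarrow> real"
  assumes "0 < a" "continuous_on {0..1} F"
  shows "continuous_on ({0..1} \<times> cbox 0 1) (\<lambda>(s, t). t powr a * F (s * t))"
  unfolding split_beta
  by (intro continuous_on_mult continuous_on_compose2[OF continuous_on_powr_const[OF assms(1)]]
      continuous_on_compose2[OF assms(2)] continuous_intros) (auto simp: mult_le_one)

lemma mean_integrand_integrable:
  fixes a s :: real and F :: "real \<Rightarrow> real"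
  assumes "0 < a" "continuous_on {0..1} F" "s \<in> {0..1}"
  shows "(\<lambda>t. t powr a * F (s * t)) integrable_on {0..1}"
  using assms(3)
  by (intro integrable_continuous_interval continuous_on_mult continuous_on_powr_const[OF assms(1)]
      continuous_on_compose2[OF assms(2)] continuous_intros) (auto simp: mult_le_one)

lemma continuous_on_radial_mean:
  assumes "0 < a" "continuous_on {0..1} F" shows "continuous_on {0..1} (radial_mean a F)"
  using integral_continuous_on_param[OF continuous_on_mean_integrand[OF assms]]
  by (simp add: radial_mean_def[abs_def] cbox_interval)

text \<open>Differentiating F (s t) in s brings out a factor t, which raises the exponent by one. In
  this averaged form the mean is as smooth as F down to s = 0, with no division by a power of the
  radius.\<close>

lemma has_real_derivative_radial_mean:
  assumes "0 < a" "\<And>s. s \<in> {0..1} \<Longrightarrow> (F has_real_derivative F' s) (at s within {0..1})"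
    "continuous_on {0..1} F'" "s \<in> {0..1}"
  shows "(radial_mean a F has_real_derivative radial_mean (a + 1) F' s) (at s within {0..1})"
proof -
  have F: "continuous_on {0..1} F" using assms(2) by (rule DERIV_continuous_on)
  have "((\<lambda>s. integral (cbox 0 1) (\<lambda>t. t powr a * F (s * t))) has_real_derivative
      integral (cbox 0 1) (\<lambda>t. t powr (a + 1) * F' (s * t))) (at s within {0..1})"
  proof (rule leibniz_rule_field_derivative[where fx="\<lambda>s t. t powr (a + 1) * F' (s * t)"])
    fix x t :: real assume x: "x \<in> {0..1}" and t: "t \<in> cbox 0 1"
    have "x * t \<in> {0..1}" using x t by (auto simp: mult_le_one)
    then have "(F has_real_derivative F' (x * t)) (at (x * t) within (\<lambda>x. x * t) ` {0..1})"
      using t by (intro DERIV_subset[OF assms(2)]) (auto simp: mult_le_one)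
    moreover have "((\<lambda>x. x * t) has_real_derivative t) (at x within {0..1})"
      by (auto intro!: derivative_eq_intros)
    ultimately have "((\<lambda>x. F (x * t)) has_real_derivative F' (x * t) * t) (at x within {0..1})"
      using DERIV_image_chain[of F "F' (x * t)" "\<lambda>x. x * t" x "{0..1}" t] by (simp add: o_def)
    from DERIV_cmult[OF this, of "t powr a"]
    show "((\<lambda>x. t powr a * F (x * t)) has_real_derivative t powr (a + 1) * F' (x * t)) (at x within {0..1})"
      using t by (cases "t = 0") (simp_all add: powr_add mult_ac)
  qed (use assms mean_integrand_integrable[OF assms(1) F] continuous_on_mean_integrand[of "a + 1" F'] in auto)
  then show ?thesis by (simp add: radial_mean_def[abs_def])
qed

text \<open>Integrate d/dt (t^p F (s t)) over [0, 1]. For p = N/2 and W' =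
  \<open>radial_mean (p - 1) F\<close> / 4 it says 4 s W'' + 2 N W' = F, so the mean does invert the
  radial Laplacian.\<close>

lemma radial_mean_by_parts:
  assumes p: "1 < p" and F: "\<And>s. s \<in> {0..1} \<Longrightarrow> (F has_real_derivative F' s) (at s within {0..1})"
    and F': "continuous_on {0..1} F'" and s: "s \<in> {0..1}"
  shows "s * radial_mean p F' s + p * radial_mean (p - 1) F s = F s"
proof -
  have cF: "continuous_on {0..1} F" using F by (rule DERIV_continuous_on)
  let ?g = "\<lambda>t. t powr p * F (s * t)"
  have "((\<lambda>t. s * (t powr p * F' (s * t)) + p * (t powr (p - 1) * F (s * t))) has_integral ?g 1 - ?g 0) {0..1}"
  proof (rule fundamental_theorem_of_calculus_interior)
    show "continuous_on {0..1} ?g"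
      using p s by (intro continuous_on_mult continuous_on_powr_const continuous_on_compose2[OF cF] continuous_intros)
        (auto simp: mult_le_one)
    fix t :: real assume t: "t \<in> {0<..<1}"
    have st: "s * t \<in> {0..1}" using s t by (auto simp: mult_le_one)
    have "(\<lambda>x. s * x) ` {0<..<1} \<subseteq> {0..1}" using s by (auto simp: mult_le_one)
    then have "(F has_real_derivative F' (s * t)) (at (s * t) within (\<lambda>x. s * x) ` {0<..<1})"
      using DERIV_subset[OF F[OF st]] by blast
    moreover have "((\<lambda>x. s * x) has_real_derivative s) (at t within {0<..<1})"
      by (auto intro!: derivative_eq_intros)
    ultimately have "((\<lambda>x. F (s * x)) has_real_derivative F' (s * t) * s) (at t within {0<..<1})"
      using DERIV_image_chain[of F "F' (s * t)" "\<lambda>x. s * x" t "{0<..<1}" s] by (simp add: o_def)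
    then have "((\<lambda>x. F (s * x)) has_real_derivative F' (s * t) * s) (at t)"
      using t by (simp add: at_within_open[of t "{0<..<1}"])
    then have "(?g has_real_derivative s * (t powr p * F' (s * t)) + p * (t powr (p - 1) * F (s * t))) (at t)"
      using t by (auto intro!: derivative_eq_intros)
    then show "(?g has_vector_derivative s * (t powr p * F' (s * t)) + p * (t powr (p - 1) * F (s * t))) (at t)"
      by (simp add: has_real_derivative_iff_has_vector_derivative)
  qed simp
  moreover have "((\<lambda>t. s * (t powr p * F' (s * t)) + p * (t powr (p - 1) * F (s * t))) has_integral
      s * radial_mean p F' s + p * radial_mean (p - 1) F s) {0..1}"
    unfolding radial_mean_def using p F' cF s
    by (intro has_integral_add has_integral_mult_right integrable_integral mean_integrand_integrable) auto
  ultimately have "?g 1 - ?g 0 = s * radial_mean p F' s + p * radial_mean (p - 1) F s"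
    by (rule has_integral_unique)
  then show ?thesis by simp
qed

lemma radial_mean_diff:
  assumes "0 < a" "continuous_on {0..1} F" "continuous_on {0..1} G" "s \<in> {0..1}"
  shows "radial_mean a (\<lambda>s. F s - G s) s = radial_mean a F s - radial_mean a G s"
  unfolding radial_mean_def
  using mean_integrand_integrable[OF assms(1,2,4)] mean_integrand_integrable[OF assms(1,3,4)]
  by (simp add: integral_diff right_diff_distrib)

lemma radial_mean_cong:
  "(\<And>s. s \<in> {0..1} \<Longrightarrow> F s = G s) \<Longrightarrow> s \<in> {0..1} \<Longrightarrow> radial_mean a F s = radial_mean a G s"
  unfolding radial_mean_def by (intro integral_cong) (auto simp: mult_le_one)

lemma radial_mean_mono:
  assumes "0 < a" "continuous_on {0..1} F" "continuous_on {0..1} G" "s \<in> {0..1}" "s' \<in> {0..1}"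
    "\<And>t. t \<in> {0..1} \<Longrightarrow> F (s * t) \<le> G (s' * t)"
  shows "radial_mean a F s \<le> radial_mean a G s'"
  unfolding radial_mean_def
  using assms by (intro integral_le mean_integrand_integrable mult_left_mono) auto

lemma radial_mean_affine:
  assumes "0 < a" shows "radial_mean a (\<lambda>s. b * s + c) s = b * s / (a + 2) + c / (a + 1)"
proof -
  have "((\<lambda>t. (b * s) * t powr (a + 1) + c * t powr a) has_integral (b * s) * (1 powr (a + 1 + 1) / (a + 1 + 1)) + c * (1 powr (a + 1) / (a + 1))) {0..1}"
    using assms by (intro has_integral_add has_integral_mult_right has_integral_powr_from_0) auto
  then have "((\<lambda>t. t powr a * (b * (s * t) + c)) has_integral b * s / (a + 2) + c / (a + 1)) {0..1}"
    by (rule has_integral_eq_rhs[OF has_integral_eq[rotated]])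
      (auto simp: powr_add algebra_simps)
  then show ?thesis by (simp add: radial_mean_def integral_unique)
qed

section \<open>The radial Green operator of the clamped bilaplacian\<close>

context
  fixes p :: real
  assumes p: "1 < p"
begin

lemma has_real_derivative_radial_inverse_laplacian:
  assumes "continuous_on {0..1} F" "s \<in> {0..1}"
  shows "(radial_inverse_laplacian p F has_real_derivative radial_mean (p - 1) F s / 4) (at s within {0..1})"
  unfolding radial_inverse_laplacian_def[abs_def] using p assms
  by (intro integral_has_real_derivative continuous_intros continuous_on_radial_mean) auto

lemma continuous_on_radial_inverse_laplacian:
  "continuous_on {0..1} F \<Longrightarrow> continuous_on {0..1} (radial_inverse_laplacian p F)"
  using has_real_derivative_radial_inverse_laplacian by (rule DERIV_continuous_on)

lemma radial_inverse_laplacian_integrable: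
  "continuous_on {0..1} F \<Longrightarrow> s \<in> {0..1} \<Longrightarrow> (\<lambda>\<sigma>. radial_mean (p - 1) F \<sigma> / 4) integrable_on {0..s}"
  using p by (intro integrable_continuous_interval continuous_intros
      continuous_on_subset[OF continuous_on_radial_mean]) auto

lemma radial_inverse_laplacian_diff:
  assumes "continuous_on {0..1} F" "continuous_on {0..1} G" "s \<in> {0..1}"
  shows "radial_inverse_laplacian p (\<lambda>s. F s - G s) s = radial_inverse_laplacian p F s - radial_inverse_laplacian p G s"
proof -
  have "radial_inverse_laplacian p (\<lambda>s. F s - G s) s =
     integral {0..s} (\<lambda>\<sigma>. radial_mean (p - 1) F \<sigma> / 4 - radial_mean (p - 1) G \<sigma> / 4)"
    unfolding radial_inverse_laplacian_def using assms p
    by (intro integral_cong) (simp add: radial_mean_diff diff_divide_distrib)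
  then show ?thesis
    unfolding radial_inverse_laplacian_def
    using radial_inverse_laplacian_integrable assms by (simp add: integral_diff)
qed

lemma radial_inverse_laplacian_cong:
  "(\<And>s. s \<in> {0..1} \<Longrightarrow> F s = G s) \<Longrightarrow> s \<in> {0..1} \<Longrightarrow> radial_inverse_laplacian p F s = radial_inverse_laplacian p G s"
  unfolding radial_inverse_laplacian_def
  by (intro integral_cong arg_cong[where f="\<lambda>x. x / 4"] radial_mean_cong) auto

lemma has_real_derivative_dirichlet_laplacian:
  assumes "continuous_on {0..1} f" "s \<in> {0..1}"
  shows "(dirichlet_laplacian p f has_real_derivative radial_mean (p - 1) f s / 4) (at s within {0..1})"
  unfolding dirichlet_laplacian_def[abs_def]
  by (rule derivative_eq_intros has_real_derivative_radial_inverse_laplacian assms refl)+ simp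

lemma continuous_on_dirichlet_laplacian:
  "continuous_on {0..1} f \<Longrightarrow> continuous_on {0..1} (dirichlet_laplacian p f)"
  using has_real_derivative_dirichlet_laplacian by (rule DERIV_continuous_on)

lemma has_real_derivative_dirichlet_green:
  assumes "continuous_on {0..1} f" "s \<in> {0..1}"
  shows "(dirichlet_green p f has_real_derivative radial_mean (p - 1) (dirichlet_laplacian p f) s / 4) (at s within {0..1})"
  unfolding dirichlet_green_def[abs_def]
  by (rule derivative_eq_intros has_real_derivative_radial_inverse_laplacian continuous_on_dirichlet_laplacian assms refl)+ simp

lemma continuous_on_dirichlet_green:
  "continuous_on {0..1} f \<Longrightarrow> continuous_on {0..1} (dirichlet_green p f)"
  using has_real_derivative_dirichlet_green by (rule DERIV_continuous_on)

text \<open>The mean with exponent p - 1 of a constant c is c / p, which cancels the factor p in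
  \<open>dirichlet_laplacian\<close>. At s = 1 the right-hand side is 0: this is the Neumann
  condition.\<close>

lemma radial_mean_dirichlet_laplacian:
  assumes "continuous_on {0..1} f" "s \<in> {0..1}"
  shows "radial_mean (p - 1) (dirichlet_laplacian p f) s =
    radial_mean (p - 1) (radial_inverse_laplacian p f) s - radial_mean (p - 1) (radial_inverse_laplacian p f) 1"
proof -
  have "radial_mean (p - 1) (dirichlet_laplacian p f) s =
    radial_mean (p - 1) (radial_inverse_laplacian p f) s -
    radial_mean (p - 1) (\<lambda>s. 0 * s + p * radial_mean (p - 1) (radial_inverse_laplacian p f) 1) s"
    unfolding dirichlet_laplacian_def[abs_def] using p assms
    by (subst radial_mean_diff) (auto intro: continuous_on_radial_inverse_laplacian)
  then show ?thesis using p by (subst (asm) radial_mean_affine) auto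
qed

lemma dirichlet_laplacian_diff:
  assumes "continuous_on {0..1} f" "continuous_on {0..1} g" "s \<in> {0..1}"
  shows "dirichlet_laplacian p (\<lambda>s. f s - g s) s = dirichlet_laplacian p f s - dirichlet_laplacian p g s"
proof -
  have "radial_mean (p - 1) (radial_inverse_laplacian p (\<lambda>s. f s - g s)) 1 =
     radial_mean (p - 1) (\<lambda>s. radial_inverse_laplacian p f s - radial_inverse_laplacian p g s) 1"
    using assms by (intro radial_mean_cong radial_inverse_laplacian_diff) auto
  then show ?thesis
    using assms p
    by (simp add: dirichlet_laplacian_def radial_inverse_laplacian_diff radial_mean_diff
        continuous_on_radial_inverse_laplacian right_diff_distrib)
qed

lemma dirichlet_green_diff:
  assumes "continuous_on {0..1} f" "continuous_on {0..1} g" "s \<in> {0..1}"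
  shows "dirichlet_green p (\<lambda>s. f s - g s) s = dirichlet_green p f s - dirichlet_green p g s"
proof -
  have "radial_inverse_laplacian p (dirichlet_laplacian p (\<lambda>s. f s - g s)) t =
     radial_inverse_laplacian p (\<lambda>s. dirichlet_laplacian p f s - dirichlet_laplacian p g s) t" if "t \<in> {0..1}" for t
    using assms that by (intro radial_inverse_laplacian_cong dirichlet_laplacian_diff) auto
  then show ?thesis
    using assms by (simp add: dirichlet_green_def radial_inverse_laplacian_diff continuous_on_dirichlet_laplacian)
qed

text \<open>Positivity in the radial class: \<open>\<Delta> G f\<close> is increasing in \<open>r\<close> and its weighted means over smaller
  balls are below the mean over the unit ball, which vanishes by the Neumann condition; so \<open>G f\<close> decreases to 0.\<close>

lemma dirichlet_green_nonneg:
  assumes f: "continuous_on {0..1} f" "\<And>s. s \<in> {0..1} \<Longrightarrow> 0 \<le> f s" and s: "s \<in> {0..1}"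
  shows "0 \<le> dirichlet_green p f s"
proof -
  have mono: "radial_inverse_laplacian p f x \<le> radial_inverse_laplacian p f y" if xy: "0 \<le> x" "x \<le> y" "y \<le> 1" for x y
  proof (rule DERIV_nonneg_imp_increasing_open[of x y])
    show "x \<le> y" by fact
    show "continuous_on {x..y} (radial_inverse_laplacian p f)"
      using xy by (intro continuous_on_subset[OF continuous_on_radial_inverse_laplacian[OF f(1)]]) auto
    fix z assume z: "x < z" "z < y"
    have "radial_mean (p - 1) (\<lambda>s. 0 * s + 0) z \<le> radial_mean (p - 1) f z"
      using z xy f p by (intro radial_mean_mono) (auto simp: mult_le_one)
    then have "0 \<le> radial_mean (p - 1) f z / 4" using p by (subst (asm) radial_mean_affine) auto
    moreover have "(radial_inverse_laplacian p f has_real_derivative radial_mean (p - 1) f z / 4) (at z)"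
      using has_real_derivative_radial_inverse_laplacian[OF f(1), of z] z xy
      by (simp add: at_within_interior[of z "{0..1}"])
    ultimately show "\<exists>d. (radial_inverse_laplacian p f has_real_derivative d) (at z) \<and> d \<ge> 0" by blast
  qed
  have neg: "radial_mean (p - 1) (dirichlet_laplacian p f) z \<le> 0" if z: "z \<in> {0..1}" for z
  proof -
    have "radial_inverse_laplacian p f (z * t) \<le> radial_inverse_laplacian p f (1 * t)" if "t \<in> {0..1}" for t
      using that z by (intro mono) (auto simp: mult_left_le_one_le)
    then have "radial_mean (p - 1) (radial_inverse_laplacian p f) z \<le> radial_mean (p - 1) (radial_inverse_laplacian p f) 1"
      using p z continuous_on_radial_inverse_laplacian[OF f(1)] by (intro radial_mean_mono) auto
    then show ?thesis by (simp add: radial_mean_dirichlet_laplacian[OF f(1) z])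
  qed
  have "dirichlet_green p f 1 \<le> dirichlet_green p f s"
  proof (rule DERIV_nonpos_imp_decreasing_open[of s 1])
    show "s \<le> 1" using s by simp
    show "continuous_on {s..1} (dirichlet_green p f)"
      using s by (intro continuous_on_subset[OF continuous_on_dirichlet_green[OF f(1)]]) auto
    fix z assume z: "s < z" "z < 1"
    then have z': "z \<in> {0..1}" using s by auto
    have "(dirichlet_green p f has_real_derivative radial_mean (p - 1) (dirichlet_laplacian p f) z / 4) (at z)"
      using has_real_derivative_dirichlet_green[OF f(1) z'] z s by (simp add: at_within_interior[of z "{0..1}"])
    with neg[OF z'] show "\<exists>d. (dirichlet_green p f has_real_derivative d) (at z) \<and> d \<le> 0" by force
  qed
  then show ?thesis by (simp add: dirichlet_green_def)
qed

lemma dirichlet_green_mono: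
  assumes "continuous_on {0..1} f" "continuous_on {0..1} g" "\<And>s. s \<in> {0..1} \<Longrightarrow> f s \<le> g s" "s \<in> {0..1}"
  shows "dirichlet_green p f s \<le> dirichlet_green p g s"
  using dirichlet_green_nonneg[of "\<lambda>s. g s - f s" s] dirichlet_green_diff[OF assms(2,1,4)] assms
  by (auto intro: continuous_intros)

text \<open>For p = N/2 and s = r^2 this is the clamped torsion function c (1 - r^2)^2 / (8 N (N +
  2)). It yields the upper bound, the Lipschitz constant and the strict positivity needed for the
  fixed point.\<close>

lemma dirichlet_green_const:
  assumes s: "s \<in> {0..1}"
  shows "dirichlet_green p (\<lambda>s. c) s = c * (1 - s)\<^sup>2 / (32 * p * (p + 1))"
proof -
  have K: "radial_inverse_laplacian p (\<lambda>s. c) s = c / (4 * p) * s + 0" if "s \<in> {0..1}" for s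
  proof -
    have "radial_mean (p - 1) (\<lambda>s. c) = (\<lambda>s. c / p)" using radial_mean_affine[of "p - 1" 0 c] p by auto
    then show ?thesis using that by (simp add: radial_inverse_laplacian_def mult.commute)
  qed
  have "radial_mean (p - 1) (radial_inverse_laplacian p (\<lambda>s. c)) s = c / (4 * p) * s / (p + 1)" if "s \<in> {0..1}" for s
  proof -
    have "radial_mean (p - 1) (radial_inverse_laplacian p (\<lambda>s. c)) s = radial_mean (p - 1) (\<lambda>s. c / (4 * p) * s + 0) s"
      using that by (intro radial_mean_cong K) auto
    also have "\<dots> = c / (4 * p) * s / (p + 1)" using p by (subst radial_mean_affine) (auto simp: add.commute)
    finally show ?thesis .
  qed
  then have J: "radial_mean (p - 1) (dirichlet_laplacian p (\<lambda>s. c)) s = c / (4 * p * (p + 1)) * (s - 1)"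
    if "s \<in> {0..1}" for s
    using that by (subst radial_mean_dirichlet_laplacian) (auto simp: divide_simps algebra_simps)
  have I: "radial_inverse_laplacian p (dirichlet_laplacian p (\<lambda>s. c)) s =
      c * (s - 1)\<^sup>2 / (32 * p * (p + 1)) - c / (32 * p * (p + 1))" if s: "s \<in> {0..1}" for s
  proof -
    have "((\<lambda>x. radial_mean (p - 1) (dirichlet_laplacian p (\<lambda>s. c)) x / 4) has_integral
      c * (s - 1)\<^sup>2 / (32 * p * (p + 1)) - c * (0 - 1)\<^sup>2 / (32 * p * (p + 1))) {0..s}"
    proof (rule fundamental_theorem_of_calculus)
      fix x assume x: "x \<in> {0..s}"
      have "((\<lambda>s. c * (s - 1)\<^sup>2 / (32 * p * (p + 1))) has_real_derivative
        c / (4 * p * (p + 1)) * (x - 1) / 4) (at x within {0..s})"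
      proof (rule DERIV_cong)
        show "((\<lambda>s. c * (s - 1)\<^sup>2 / (32 * p * (p + 1))) has_real_derivative
          c * (2 * (x - 1)) / (32 * p * (p + 1))) (at x within {0..s})"
          by (intro DERIV_cdivide DERIV_cmult) (auto intro!: derivative_eq_intros)
        show "c * (2 * (x - 1)) / (32 * p * (p + 1)) = c / (4 * p * (p + 1)) * (x - 1) / 4"
          using p by (simp add: divide_simps) (simp add: algebra_simps)
      qed
      then show "((\<lambda>s. c * (s - 1)\<^sup>2 / (32 * p * (p + 1))) has_vector_derivative
         radial_mean (p - 1) (dirichlet_laplacian p (\<lambda>s. c)) x / 4) (at x within {0..s})"
        using J[of x] x s by (simp add: has_real_derivative_iff_has_vector_derivative)
    qed (use s in simp)
    then show ?thesis by (simp only: radial_inverse_laplacian_def integral_unique) simp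
  qed
  show ?thesis
    using I[OF s] I[of 1] by (simp add: dirichlet_green_def power2_commute)
qed

end

text \<open>27/4 = 2 (3/2)^3 is the derivative of (1 - y)^(-2) at y = 1/3.\<close>

lemma inverse_square_lipschitz:
  fixes a b :: real assumes "0 \<le> a" "a \<le> 1/3" "0 \<le> b" "b \<le> 1/3"
  shows "\<bar>1 / (1 - a)\<^sup>2 - 1 / (1 - b)\<^sup>2\<bar> \<le> 27/4 * \<bar>a - b\<bar>"
proof -
  define x y where "x = 1 / (1 - a)" and "y = 1 / (1 - b)"
  have x: "0 \<le> x" "x \<le> 3/2" and y: "0 \<le> y" "y \<le> 3/2"
    using assms by (auto simp: x_def y_def divide_simps)
  have "1 / (1 - a)\<^sup>2 - 1 / (1 - b)\<^sup>2 = (x - y) * (x + y)"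
    by (simp add: x_def y_def power_divide power2_eq_square algebra_simps)
  also have "x - y = (a - b) * (x * y)"
    using assms by (simp add: x_def y_def divide_simps)
  finally have "\<bar>1 / (1 - a)\<^sup>2 - 1 / (1 - b)\<^sup>2\<bar> = \<bar>a - b\<bar> * (x * y * (x + y))"
    using x y by (simp add: abs_mult)
  also have "\<dots> \<le> \<bar>a - b\<bar> * (3/2 * (3/2) * (3/2 + 3/2))"
    using x y by (intro mult_left_mono mult_mono add_mono) auto
  finally show ?thesis by simp
qed

text \<open>The height 1/3 maximises M (1 - M)^2. On it the source is at most 9/4 l, and the limit
  on l then gives both the bound 1/4 (1 - s)^2 and the contraction constant 3/4. For p = N/2 the
  limit is 8/9 N (N + 2), which lies above 8/9 (N - 2/3) (N - 8/3).\<close>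

lemma exists_dirichlet_fixed_point:
  assumes p: "1 < p" and l: "0 \<le> l" "l \<le> 32/9 * p * (p + 1)"
  obtains v where "continuous_on {0..1} v" "\<And>s. s \<in> {0..1} \<Longrightarrow> 0 \<le> v s"
    "\<And>s. s \<in> {0..1} \<Longrightarrow> v s \<le> 1/4 * (1 - s)\<^sup>2"
    "\<And>s. s \<in> {0..1} \<Longrightarrow> v s = dirichlet_green p (\<lambda>s. l / (1 - v s)\<^sup>2) s"
proof -
  \<comment> \<open>Clamping to [0, 1] extends functions on the interval to bounded continuous
    functions on the line, a complete space in which Banach's theorem applies.\<close>
  define C :: "real \<Rightarrow> real" where "C s = max 0 (min 1 s)" for s
  have C: "C s \<in> {0..1}" "s \<in> {0..1} \<Longrightarrow> C s = s" for s by (auto simp: C_def)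
  have contC: "continuous_on UNIV C" unfolding C_def by (intro continuous_intros)
  define X :: "(real \<Rightarrow>\<^sub>C real) set" where "X = PiC UNIV (\<lambda>_. {0..1/3})"
  have X: "v \<in> X \<longleftrightarrow> (\<forall>s. 0 \<le> apply_bcontfun v s \<and> apply_bcontfun v s \<le> 1/3)" for v
    by (simp add: X_def mem_PiC_iff Pi_iff)
  define f where "f v s = l / (1 - apply_bcontfun v s)\<^sup>2" for v and s :: real
  have fcont: "continuous_on {0..1} (f v)" if "v \<in> X" for v
  proof -
    have "apply_bcontfun v s \<noteq> 1" for s using that[unfolded X, rule_format, of s] by auto
    then show ?thesis unfolding f_def by (intro continuous_intros) auto
  qed
  have fb: "0 \<le> f v s \<and> f v s \<le> 9/4 * l" if "v \<in> X" for v s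
  proof -
    have "2/3 \<le> 1 - apply_bcontfun v s" using that[unfolded X, rule_format, of s] by simp
    then have "(2/3)^2 \<le> (1 - apply_bcontfun v s)^2" by (intro power_mono) auto
    then have "l / (1 - apply_bcontfun v s)^2 \<le> l / (2/3)^2"
      using l by (intro divide_left_mono) (auto simp: power2_eq_square)
    then show ?thesis using l by (simp add: f_def power2_eq_square)
  qed
  have l': "9/4 * l / (32 * p * (p + 1)) \<le> 1/4" using p l(2) by (simp add: divide_simps)
  have bound: "0 \<le> dirichlet_green p (f v) s \<and> dirichlet_green p (f v) s \<le> 1/4 * (1 - s)\<^sup>2"
    if v: "v \<in> X" and s: "s \<in> {0..1}" for v s
  proof
    show "0 \<le> dirichlet_green p (f v) s"
      using fb[OF v] by (intro dirichlet_green_nonneg p fcont v s) auto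
    have "dirichlet_green p (f v) s \<le> dirichlet_green p (\<lambda>_. 9/4 * l) s"
      using fb[OF v] by (intro dirichlet_green_mono p fcont v s) auto
    also have "\<dots> = 9/4 * l / (32 * p * (p + 1)) * (1 - s)\<^sup>2"
      using dirichlet_green_const[OF p s, of "9/4 * l"] by simp
    also have "\<dots> \<le> 1/4 * (1 - s)\<^sup>2" using l' by (intro mult_right_mono) auto
    finally show "dirichlet_green p (f v) s \<le> 1/4 * (1 - s)\<^sup>2" .
  qed
  have small: "1/4 * (1 - s)\<^sup>2 \<le> 1/3" if "s \<in> {0..1}" for s :: real
    using that power_le_one[of "1 - s" 2] by simp
  define T where "T v = Bcontfun (\<lambda>s. dirichlet_green p (f v) (C s))" for v
  have T: "apply_bcontfun (T v) s = dirichlet_green p (f v) (C s)" if v: "v \<in> X" for v s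
  proof -
    have "continuous_on UNIV (\<lambda>s. dirichlet_green p (f v) (C s))"
      using C(1) by (intro continuous_on_compose2[OF continuous_on_dirichlet_green[OF p fcont[OF v]] contC]) auto
    moreover have "norm (dirichlet_green p (f v) (C s)) \<le> 1/3" for s
      using bound[OF v C(1)[of s]] small[OF C(1)[of s]] by auto
    ultimately have "(\<lambda>s. dirichlet_green p (f v) (C s)) \<in> bcontfun" by (rule bcontfun_normI)
    then show ?thesis by (simp add: T_def Bcontfun_inverse)
  qed
  have TX: "T ` X \<subseteq> X"
  proof (rule image_subsetI)
    fix v assume v: "v \<in> X"
    have "0 \<le> apply_bcontfun (T v) s \<and> apply_bcontfun (T v) s \<le> 1/3" for s
      using bound[OF v C(1)[of s]] small[OF C(1)[of s]] by (auto simp: T[OF v])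
    then show "T v \<in> X" by (simp add: X)
  qed
  have lip: "dist (T v) (T w) \<le> 3/4 * dist v w" if v: "v \<in> X" and w: "w \<in> X" for v w
  proof (rule dist_bound)
    fix s
    let ?d = "27/4 * l * dist v w"
    have d: "\<bar>f v t - f w t\<bar> \<le> ?d" for t
    proof -
      have "\<bar>f v t - f w t\<bar> = l * \<bar>1 / (1 - apply_bcontfun v t)\<^sup>2 - 1 / (1 - apply_bcontfun w t)\<^sup>2\<bar>"
      proof -
        have "f v t - f w t = l * (1 / (1 - apply_bcontfun v t)\<^sup>2 - 1 / (1 - apply_bcontfun w t)\<^sup>2)"
          by (simp add: f_def right_diff_distrib)
        then show ?thesis using l(1) by (simp only: abs_mult abs_of_nonneg)
      qed
      also have "\<dots> \<le> l * (27/4 * \<bar>apply_bcontfun v t - apply_bcontfun w t\<bar>)"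
        using v w l unfolding X by (intro mult_left_mono inverse_square_lipschitz) auto
      also have "\<dots> \<le> l * (27/4 * dist v w)"
        using l dist_bounded[of v t w] by (intro mult_left_mono) (auto simp: dist_real_def)
      finally show ?thesis by simp
    qed
    have "\<bar>dirichlet_green p (f v) (C s) - dirichlet_green p (f w) (C s)\<bar> \<le> dirichlet_green p (\<lambda>_. ?d) (C s)"
    proof -
      have "dirichlet_green p (\<lambda>s. f v s - f w s) (C s) \<le> dirichlet_green p (\<lambda>_. ?d) (C s)"
        "dirichlet_green p (\<lambda>s. f w s - f v s) (C s) \<le> dirichlet_green p (\<lambda>_. ?d) (C s)"
        using d[unfolded abs_le_iff] by (intro dirichlet_green_mono p C continuous_intros fcont v w; simp)+
      then show ?thesis
        using dirichlet_green_diff[OF p fcont[OF v] fcont[OF w] C(1)] dirichlet_green_diff[OF p fcont[OF w] fcont[OF v] C(1)]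
        by simp
    qed
    also have "\<dots> = 27/4 * l / (32 * p * (p + 1)) * (dist v w * (1 - C s)\<^sup>2)"
      using dirichlet_green_const[OF p C(1), of ?d] by simp
    also have "\<dots> \<le> 3/4 * (dist v w * 1)"
    proof (rule mult_mono)
      show "27/4 * l / (32 * p * (p + 1)) \<le> 3/4" using p l(2) by (simp add: divide_simps)
      show "dist v w * (1 - C s)\<^sup>2 \<le> dist v w * 1"
        using C(1)[of s] by (intro mult_left_mono power_le_one) auto
    qed auto
    finally show "dist (apply_bcontfun (T v) s) (apply_bcontfun (T w) s) \<le> 3/4 * dist v w"
      by (simp add: T v w dist_real_def)
  qed
  have "complete X" unfolding complete_eq_closed X_def by (intro closed_PiC) simp
  moreover have "const_bcontfun 0 \<in> X" by (simp add: X)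
  ultimately have "\<exists>!v. v \<in> X \<and> T v = v"
    by (intro Banach_fix[where c="3/4"] TX ballI lip) auto
  then obtain v where v: "v \<in> X" "T v = v" by blast
  have fp: "apply_bcontfun v s = dirichlet_green p (f v) s" if "s \<in> {0..1}" for s
    using T[OF v(1), of s] v(2) C(2)[OF that] by simp
  show ?thesis
  proof (rule that[of "apply_bcontfun v"])
    show "apply_bcontfun v s \<le> 1/4 * (1 - s)\<^sup>2" if "s \<in> {0..1}" for s
      using bound[OF v(1) that] fp[OF that] by simp
    show "0 \<le> apply_bcontfun v s" for s using v(1) by (simp add: X)
    show "apply_bcontfun v s = dirichlet_green p (\<lambda>s. l / (1 - apply_bcontfun v s)\<^sup>2) s" if "s \<in> {0..1}" for s
      using fp[OF that] by (simp add: f_def[abs_def])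
  qed simp
qed

lemma exists_classical_solution:
  assumes l: "0 < l" "l \<le> 8/9 * real DIM('a::euclidean_space) * (real DIM('a::euclidean_space) + 2)" and N: "3 \<le> DIM('a::euclidean_space)"
  obtains u :: "'a::euclidean_space \<Rightarrow> real" where "classical_solution l u" "\<And>x. x \<in> ball 0 1 \<Longrightarrow> u x \<le> 1/4 * (1 - (norm x)\<^sup>2)\<^sup>2"
proof -
  define p :: real where "p = DIM('a) / 2"
  have p: "1 < p" using N by (simp add: p_def)
  have lp: "l \<le> 32/9 * p * (p + 1)" using l(2) by (simp add: p_def algebra_simps)
  obtain v where v: "continuous_on {0..1} v" "\<And>s. s \<in> {0..1} \<Longrightarrow> 0 \<le> v s"
    "\<And>s. s \<in> {0..1} \<Longrightarrow> v s \<le> 1/4 * (1 - s)\<^sup>2"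
    "\<And>s. s \<in> {0..1} \<Longrightarrow> v s = dirichlet_green p (\<lambda>s. l / (1 - v s)\<^sup>2) s"
    by (rule exists_dirichlet_fixed_point[OF p less_imp_le[OF l(1)] lp]) (rule that, assumption+)
  have v1: "v s < 1" if "s \<in> {0..1}" for s
    using v(3)[OF that] that power_le_one[of "1 - s" 2] by auto
  define f where "f s = l / (1 - v s)\<^sup>2" for s
  have f_eq: "f = (\<lambda>s. l / (1 - v s)\<^sup>2)" by (rule ext) (rule f_def)
  have v4: "v s = dirichlet_green p f s" if "s \<in> {0..1}" for s unfolding f_eq by (rule v(4)[OF that])
  have f: "continuous_on {0..1} f" unfolding f_def using v1 by (intro continuous_intros v) force
  define z z1 where "z = dirichlet_laplacian p f" and "z1 s = radial_mean (p - 1) f s / 4" for s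
  define w where "w s = radial_mean (p - 1) z s / 4" for s
  have dz: "(z has_real_derivative z1 s) (at s within {0..1})" if "s \<in> {0..1}" for s
    unfolding z_def z1_def by (rule has_real_derivative_dirichlet_laplacian[OF p f that])
  have dv: "(v has_real_derivative w s) (at s within {0..1})" if "s \<in> {0..1}" for s
    using has_real_derivative_dirichlet_green[OF p f that] unfolding w_def z_def
    by (rule has_field_derivative_transform_within[OF _ zero_less_one that]) (simp only: v4)
  have cz: "continuous_on {0..1} z" using dz by (rule DERIV_continuous_on)
  have mean: "continuous_on {0..1} (\<lambda>s. radial_mean a F s / 4)" if "0 < a" "continuous_on {0..1} F" for a F
    using continuous_on_radial_mean[OF that] by (intro continuous_intros) auto
  have dmean: "((\<lambda>s. radial_mean a F s / 4) has_real_derivative radial_mean (a + 1) F' s / 4) (at s within {0..1})"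
    if "0 < a" "\<And>s. s \<in> {0..1} \<Longrightarrow> (F has_real_derivative F' s) (at s within {0..1})"
      "continuous_on {0..1} F'" "s \<in> {0..1}" for a F F' s
    using has_real_derivative_radial_mean[OF that] by (rule DERIV_cdivide)
  have cw: "continuous_on {0..1} w" unfolding w_def using p cz by (intro mean) auto
  have cz1: "continuous_on {0..1} z1" unfolding z1_def using p f by (intro mean) auto
  define w1 where "w1 s = radial_mean p z1 s / 4" for s
  have dw: "(w has_real_derivative w1 s) (at s within {0..1})" if "s \<in> {0..1}" for s
    using dmean[OF _ dz cz1 that, of "p - 1"] p unfolding w_def[abs_def] w1_def by simp
  have cw1: "continuous_on {0..1} w1" unfolding w1_def using p cz1 by (intro mean) auto
  \<comment> \<open>Bootstrapping: continuity of f alone has produced v' = w and v'' = w1. These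
    suffice to differentiate f twice, and the means of f' and f'' yield the third and fourth
    derivatives of v.\<close>
  define q where "q s = inverse (1 - v s)" for s
  define f1 where "f1 s = 2 * l * w s * q s ^ 3" for s
  define f2 where "f2 s = 2 * l * w1 s * q s ^ 3 + 6 * l * (w s)\<^sup>2 * q s ^ 4" for s
  have ne: "1 - v s \<noteq> 0" if "s \<in> {0..1}" for s using v1[OF that] by simp
  have f_q: "f = (\<lambda>s. l * (q s)\<^sup>2)" by (simp add: f_eq q_def divide_inverse power_inverse)
  have dq: "(q has_real_derivative w s * (q s)\<^sup>2) (at s within {0..1})" if "s \<in> {0..1}" for s
    unfolding q_def using ne[OF that]
    by (auto intro!: derivative_eq_intros dv that simp: power2_eq_square)
  have cq: "continuous_on {0..1} q" using dq by (rule DERIV_continuous_on)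
  have df: "(f has_real_derivative f1 s) (at s within {0..1})" if "s \<in> {0..1}" for s
    unfolding f_q f1_def
    by (auto intro!: derivative_eq_intros dq that simp: eval_nat_numeral algebra_simps)
  have df1: "(f1 has_real_derivative f2 s) (at s within {0..1})" if "s \<in> {0..1}" for s
    unfolding f1_def[abs_def] f2_def
    by (auto intro!: derivative_eq_intros dq dw that simp: eval_nat_numeral algebra_simps)
  have cf1: "continuous_on {0..1} f1" using df1 by (rule DERIV_continuous_on)
  have cf2: "continuous_on {0..1} f2"
    unfolding f2_def by (intro continuous_intros cw cw1 cq)
  define z2 where "z2 s = radial_mean p f1 s / 4" for s
  define z3 where "z3 s = radial_mean (p + 1) f2 s / 4" for s
  have dz1: "(z1 has_real_derivative z2 s) (at s within {0..1})" if "s \<in> {0..1}" for s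
    using dmean[OF _ df cf1 that, of "p - 1"] p unfolding z1_def[abs_def] z2_def by simp
  have dz2: "(z2 has_real_derivative z3 s) (at s within {0..1})" if "s \<in> {0..1}" for s
    using dmean[OF _ df1 cf2 that, of p] p unfolding z2_def[abs_def] z3_def by simp
  have cz2: "continuous_on {0..1} z2" using dz2 by (rule DERIV_continuous_on)
  have cz3: "continuous_on {0..1} z3" unfolding z3_def using p cf2 by (intro mean) auto
  define w2 where "w2 s = radial_mean (p + 1) z2 s / 4" for s
  define w3 where "w3 s = radial_mean (p + 2) z3 s / 4" for s
  have dw1: "(w1 has_real_derivative w2 s) (at s within {0..1})" if "s \<in> {0..1}" for s
    using dmean[OF _ dz1 cz2 that, of p] p unfolding w1_def[abs_def] w2_def by simp
  have dw2: "(w2 has_real_derivative w3 s) (at s within {0..1})" if "s \<in> {0..1}" for s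
    using dmean[OF _ dz2 cz3 that, of "p + 1"] p unfolding w2_def[abs_def] w3_def by (simp add: add.assoc)
  have cw3: "continuous_on {0..1} w3" unfolding w3_def using p cz3 by (intro mean) auto
  define W where "W j = [v, w, w1, w2, w3] ! j" for j
  have W: "(W j has_real_derivative W (Suc j) s) (at s within {0..1})" if "j < 4" "s \<in> {0..1}" for j s
    using that dv dw dw1 dw2 by (auto simp: W_def less_Suc_eq numeral_eq_Suc)
  have W_simps: "W 0 = v" "W (Suc 0) = w" "W 4 = w3" by (simp_all add: W_def)
  define u :: "'a \<Rightarrow> real" where "u x = v (x \<bullet> x)" for x
  have sq: "x \<bullet> x \<in> {0..1}" if "x \<in> cball 0 1" for x :: 'a
    using that by (simp add: dot_square_norm power_le_one)
  have sqb: "x \<bullet> x \<in> {0..1}" if "x \<in> ball 0 1" for x :: 'a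
    using that by (intro sq) auto
  have sq1: "x \<bullet> x < 1" if "x \<in> ball 0 1" for x :: 'a
    using that power_strict_mono[of "norm x" 1 2] by (simp add: dot_square_norm)
  have lapz: "laplacian u x = z (x \<bullet> x)" if "x \<in> ball 0 1" for x
  proof -
    have "laplacian u x = 4 * (x \<bullet> x) * w1 (x \<bullet> x) + 2 * DIM('a) * w (x \<bullet> x)"
      unfolding u_def[abs_def] by (rule laplacian_radial[OF _ that sqb dv dw]) auto
    also have "\<dots> = z (x \<bullet> x)"
      using radial_mean_by_parts[OF p dz cz1 sqb[OF that]] by (simp add: w1_def w_def p_def)
    finally show ?thesis .
  qed
  have "laplacian (laplacian u) x = f (x \<bullet> x)" if "x \<in> ball 0 1" for x
  proof -
    have "laplacian (laplacian u) x = laplacian (\<lambda>x. z (x \<bullet> x)) x"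
      by (rule laplacian_cong[OF _ that lapz]) auto
    also have "\<dots> = 4 * (x \<bullet> x) * z2 (x \<bullet> x) + 2 * DIM('a) * z1 (x \<bullet> x)"
      by (rule laplacian_radial[OF _ that sqb dz dz1]) auto
    also have "\<dots> = f (x \<bullet> x)"
      using radial_mean_by_parts[OF p df cf1 sqb[OF that]] by (simp add: z2_def z1_def p_def)
    finally show ?thesis .
  qed
  moreover have "C_k_on 4 u (ball 0 1)"
  proof -
    have "C_k_on 4 (\<lambda>x::'a. W 0 (x \<bullet> x)) (ball 0 1)"
      by (rule C_k_on_radial[OF unique_derivs_open sqb]) (simp_all add: W W_simps cw3)
    then show ?thesis by (simp add: W_simps u_def[abs_def])
  qed
  moreover have "C_k_on 1 u (cball 0 1)"
  proof -
    have "C_k_on 1 (\<lambda>x::'a. W 0 (x \<bullet> x)) (cball 0 1)"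
      by (rule C_k_on_radial[OF unique_derivs_cball sq]) (simp_all add: W_simps cw dv)
    then show ?thesis by (simp add: W_simps u_def[abs_def])
  qed
  moreover have "0 < u x \<and> u x < 1" if x: "x \<in> ball 0 1" for x
  proof -
    let ?s = "x \<bullet> x"
    \<comment> \<open>Strict positivity: the source f is at least the constant l and the Green
      operator is monotone.\<close>
    have "0 < l * (1 - ?s)\<^sup>2 / (32 * p * (p + 1))"
      using l(1) p sq1[OF x] by simp
    also have "\<dots> = dirichlet_green p (\<lambda>_. l) ?s" using dirichlet_green_const[OF p sqb[OF x]] by simp
    also have "\<dots> \<le> dirichlet_green p f ?s"
    proof (rule dirichlet_green_mono[OF p _ f _ sqb[OF x]])
      fix s :: real assume s: "s \<in> {0..1}"
      have "(1 - v s)\<^sup>2 \<le> 1" using v(2)[OF s] v1[OF s] by (intro power_le_one) auto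
      then show "l \<le> f s" using l(1) ne[OF s] by (simp add: f_def divide_simps)
    qed simp
    also have "\<dots> = u x" by (simp only: u_def v4[OF sqb[OF x]])
    finally show ?thesis using v1[OF sqb[OF x]] by (simp add: u_def)
  qed
  moreover have "u x = 0 \<and> normal_deriv u x = 0" if x: "x \<in> sphere 0 1" for x
  proof
    have xx: "x \<bullet> x = 1" using x by (simp add: dot_square_norm)
    then show "u x = 0" using v(2)[of 1] v(3)[of 1] by (simp add: u_def)
    have xc: "x \<in> cball 0 1" using x by simp
    have "w 1 = 0"
      using radial_mean_dirichlet_laplacian[OF p f, of 1] by (simp add: w_def z_def)
    have "(u has_derivative (\<lambda>h. w (x \<bullet> x) * (2 * (x \<bullet> h)))) (at x within cball 0 1)"
      unfolding u_def[abs_def] using dv xx by (intro has_derivative_radial[of _ _ _ "{0..1}"] sq) auto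
    from frechet_derivative_within_eq[OF unique_derivs_cball xc this] show "normal_deriv u x = 0"
      by (simp add: normal_deriv_def xx \<open>w 1 = 0\<close>)
  qed
  ultimately have "classical_solution l u"
    by (simp add: classical_solution_def f_def u_def)
  moreover have "u x \<le> 1/4 * (1 - (norm x)\<^sup>2)\<^sup>2" if "x \<in> ball 0 1" for x
    using v(3)[OF sqb[OF that]] by (simp add: u_def dot_square_norm)
  ultimately show ?thesis by (rule that)
qed

section \<open>Radial symmetry of minimal solutions\<close>

text \<open>The Householder reflection along x - y. Such maps act transitively on spheres and are
  their own adjoints, which spares the treatment of general orthogonal maps.\<close>

lemma exists_reflection:
  fixes x y :: "'a::euclidean_space" assumes "norm x = norm y"
  obtains Q :: "'a \<Rightarrow> 'a" where "bounded_linear Q" "\<And>a b. Q a \<bullet> b = a \<bullet> Q b" "\<And>a. Q (Q a) = a" "Q x = y"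
proof (cases "x = y")
  case True
  then show ?thesis using bounded_linear_ident by (intro that[of "\<lambda>a. a"]) auto
next
  case False
  define n where "n = x - y"
  have nn: "n \<bullet> n \<noteq> 0" using False by (simp add: n_def)
  define Q where "Q a = a - (2 * (a \<bullet> n) / (n \<bullet> n)) *\<^sub>R n" for a
  have xy: "x \<bullet> x = y \<bullet> y" using assms by (simp add: dot_square_norm)
  have "n \<bullet> n = 2 * (x \<bullet> n)" using xy by (simp add: n_def inner_diff inner_commute)
  then have "Q x = y" using nn by (simp add: Q_def) (simp add: n_def)
  moreover have "bounded_linear Q" unfolding Q_def[abs_def] divide_inverse
    by (intro bounded_linear_sub bounded_linear_ident bounded_linear_scaleR_const
        bounded_linear_mult_const bounded_linear_const_mult bounded_linear_inner_left)
  moreover have "Q a \<bullet> b = a \<bullet> Q b" for a b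
    by (simp add: Q_def inner_diff inner_commute)
  moreover have "Q (Q a) = a" for a
    using nn by (simp add: Q_def inner_diff algebra_simps flip: scaleR_add_left)
  ultimately show ?thesis using that by blast
qed

lemma classical_solution_compose_isometry:
  fixes Q :: "'a::euclidean_space \<Rightarrow> 'a"
  assumes u: "classical_solution l u"
    and Q: "bounded_linear Q" "\<And>a b. Q a \<bullet> b = a \<bullet> Q b" "\<And>a. Q (Q a) = a"
  shows "classical_solution l (\<lambda>x. u (Q x))"
proof -
  have n: "norm (Q x) = norm x" for x by (simp add: norm_eq_sqrt_inner Q(2,3))
  have C: "C_k_on 4 u (ball 0 1)" "C_k_on 1 u (cball 0 1)" using u by (simp_all add: classical_solution_def)
  have C4: "C_k_on (Suc (Suc 2)) u (ball 0 1)" using C(1) by (simp add: numeral_eq_Suc)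
  have C2: "C_k_on (Suc (Suc 0)) u (ball 0 1)" by (rule C_k_on_le[OF C4]) simp
  have L2: "C_k_on (Suc (Suc 0)) (laplacian u) (ball 0 1)"
    using C_k_on_laplacian[OF open_ball C4] by (simp add: numeral_2_eq_2)
  have lap: "laplacian (laplacian (\<lambda>x. u (Q x))) x = laplacian (laplacian u) (Q x)" if x: "x \<in> ball 0 1" for x
  proof -
    have "laplacian (laplacian (\<lambda>x. u (Q x))) x = laplacian (\<lambda>x. laplacian u (Q x)) x"
      by (rule laplacian_cong[OF open_ball x], rule laplacian_compose_isometry[OF open_ball _ _ C2 Q]) (simp_all add: n)
    also have "\<dots> = laplacian (laplacian u) (Q x)"
      using x by (intro laplacian_compose_isometry[OF open_ball _ _ L2 Q]) (simp_all add: n)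
    finally show ?thesis .
  qed
  have nd: "normal_deriv (\<lambda>x. u (Q x)) x = 0" if x: "x \<in> sphere 0 1" for x
  proof -
    have xc: "x \<in> cball 0 1" and Qx: "Q x \<in> sphere 0 1" using x by (simp_all add: n)
    have "((\<lambda>x. u (Q x)) has_derivative (\<lambda>h. frechet_derivative u (at (Q x) within cball 0 1) (Q h))) (at x within cball 0 1)"
    proof (rule has_derivative_in_compose2[where t="cball 0 1" and g=u and f=Q])
      show "(u has_derivative frechet_derivative u (at y within cball 0 1)) (at y within cball 0 1)"
        if "y \<in> cball 0 1" for y
        using C_k_on_has_derivative[of 0 u] C(2) that by (simp only: One_nat_def)
      show "Q ` cball 0 1 \<subseteq> cball 0 1" by (auto simp: n)
    qed (use xc bounded_linear_imp_has_derivative[OF Q(1)] in auto)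
    from frechet_derivative_within_eq[OF unique_derivs_cball xc this]
    have "normal_deriv (\<lambda>x. u (Q x)) x = normal_deriv u (Q x)" by (simp add: normal_deriv_def)
    then show ?thesis using u Qx by (simp add: classical_solution_def)
  qed
  have "C_k_on 4 (\<lambda>x. u (Q x)) (ball 0 1)" "C_k_on 1 (\<lambda>x. u (Q x)) (cball 0 1)"
    by (rule C_k_on_compose_linear[OF unique_derivs_open[OF open_ball] Q(1) _ C(1)], simp add: n)
       (rule C_k_on_compose_linear[OF unique_derivs_cball Q(1) _ C(2)], simp add: n)
  then show ?thesis
    using u lap nd by (simp add: classical_solution_def n)
qed

text \<open>u o Q solves the same problem, so u <= u o Q by minimality; evaluating this at z and at
  Q z gives equality. The Laplacian is included because the fourth-order equation will be read as
  two second-order equations along a ray.\<close>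

lemma minimal_solution_radial:
  fixes u :: "'a::euclidean_space \<Rightarrow> real"
  assumes u: "minimal_solution l u" and xy: "norm x = norm y" "x \<in> ball 0 1"
  shows "u x = u y" "laplacian u x = laplacian u y"
proof -
  have le: "u (Q z) = u z" if Q: "bounded_linear Q" "\<And>a b. Q a \<bullet> b = a \<bullet> Q b" "\<And>a. Q (Q a) = a" and z: "z \<in> ball 0 1"
    for Q and z :: 'a
  proof -
    have n: "norm (Q x) = norm x" for x by (simp add: norm_eq_sqrt_inner Q(2,3))
    have cl: "classical_solution l (\<lambda>x. u (Q x))"
      by (rule classical_solution_compose_isometry[OF _ Q]) (use u in \<open>simp add: minimal_solution_def\<close>)
    have "u w \<le> u (Q w)" if "w \<in> ball 0 1" for w
      using conjunct2[OF u[unfolded minimal_solution_def], rule_format, OF cl that] .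
    from this[of z] this[of "Q z"] show ?thesis using z by (simp add: n Q(3))
  qed
  obtain Q :: "'a \<Rightarrow> 'a" where Q: "bounded_linear Q" "\<And>a b. Q a \<bullet> b = a \<bullet> Q b" "\<And>a. Q (Q a) = a" "Q x = y"
    using exists_reflection[OF xy(1)] by blast
  have n: "norm (Q x) = norm x" for x by (simp add: norm_eq_sqrt_inner Q(2,3))
  show "u x = u y" using le[OF Q(1-3) xy(2)] Q(4) by simp
  have "C_k_on 4 u (ball 0 1)" using u by (simp add: minimal_solution_def classical_solution_def)
  then have C2: "C_k_on (Suc (Suc 0)) u (ball 0 1)" by (rule C_k_on_le) simp
  have "laplacian u x = laplacian (\<lambda>x. u (Q x)) x"
    by (rule laplacian_cong[OF open_ball xy(2)]) (simp add: le[OF Q(1-3)])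
  also have "\<dots> = laplacian u y"
    using xy(2) by (subst laplacian_compose_isometry[OF open_ball _ _ C2 Q(1-3)]) (simp_all add: n Q(4))
  finally show "laplacian u x = laplacian u y" .
qed

lemma has_real_derivative_along_line:
  fixes f :: "'a::euclidean_space \<Rightarrow> real"
  assumes "(f has_derivative D) (at (r *\<^sub>R e))"
  shows "((\<lambda>r. f (r *\<^sub>R e)) has_real_derivative D e) (at r)"
proof -
  interpret D: bounded_linear D using assms by (rule has_derivative_bounded_linear)
  have "((\<lambda>s. s *\<^sub>R e) has_derivative (\<lambda>h. h *\<^sub>R e)) (at r)"
    by (auto intro!: derivative_eq_intros)
  from has_derivative_compose[OF this assms] show ?thesis
    by (simp add: has_field_derivative_def D.scaleR mult.commute[of _ "D _"])
qed

text \<open>Off the origin the gradient is g'(|y|) y / |y|. On the ray, each of the N - 1 basis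
  directions b other than e contributes g'(r) / r to the Laplacian, since y . b vanishes at r e and
  only its derivative survives.\<close>

lemma radial_function_ode:
  fixes f :: "'a::euclidean_space \<Rightarrow> real"
  assumes f: "C_k_on (Suc (Suc 0)) f (ball 0 1)"
    and rad: "\<And>x y. x \<in> ball 0 1 \<Longrightarrow> norm x = norm y \<Longrightarrow> f x = f y"
    and e: "e \<in> Basis" and r: "0 < r" "r < 1"
  shows "((\<lambda>r. f (r *\<^sub>R e)) has_real_derivative partial_deriv e f (r *\<^sub>R e)) (at r)"
    "((\<lambda>r. partial_deriv e f (r *\<^sub>R e)) has_real_derivative
       laplacian f (r *\<^sub>R e) - (real DIM('a) - 1) * partial_deriv e f (r *\<^sub>R e) / r) (at r)"
proof -
  let ?g = "\<lambda>r. f (r *\<^sub>R e)" and ?g1 = "\<lambda>r. partial_deriv e f (r *\<^sub>R e)"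
  have inb: "s *\<^sub>R e \<in> ball 0 1" if "0 < s" "s < 1" for s using that e by simp
  have g: "(?g has_real_derivative ?g1 s) (at s)" if "0 < s" "s < 1" for s
    by (rule has_real_derivative_along_line[OF C_k_on_open_has_derivative[OF C_k_on_SucD[OF f] open_ball inb[OF that]]])
  show "(?g has_real_derivative ?g1 r) (at r)" using g[OF r] .
  have pd: "C_k_on (Suc 0) (partial_deriv e f) (ball 0 1)" using C_k_on_partial_deriv[OF open_ball f e] .
  have g1: "(?g1 has_real_derivative partial_deriv e (partial_deriv e f) (s *\<^sub>R e)) (at s)" if "0 < s" "s < 1" for s
    by (rule has_real_derivative_along_line[OF C_k_on_open_has_derivative[OF pd open_ball inb[OF that]]])
  let ?S = "ball 0 1 - {0::'a}"
  have S: "open ?S" by auto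
  have x: "r *\<^sub>R e \<in> ?S" using r e by auto
  have dn: "((\<lambda>y. G (norm y)) has_derivative (\<lambda>h. G' * (h \<bullet> sgn y))) (at y)"
    if "(G has_real_derivative G') (at (norm y))" "y \<noteq> 0" for G G' and y :: 'a
    using has_derivative_compose[OF has_derivative_norm[OF that(2)], of G "(*) G'"] that(1)
    by (simp add: has_field_derivative_def)
  have pb: "partial_deriv b f y = ?g1 (norm y) / norm y * (y \<bullet> b)" if y: "y \<in> ?S" for b y
  proof -
    have "partial_deriv b f y = partial_deriv b (\<lambda>y. ?g (norm y)) y"
      using e by (intro partial_deriv_cong[OF S y] rad) auto
    also have "\<dots> = ?g1 (norm y) * (b \<bullet> sgn y)"
      using y by (intro partial_deriv_eq[OF dn] g) auto
    finally show ?thesis by (simp add: sgn_div_norm inner_commute divide_inverse)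
  qed
  have pbb: "partial_deriv b (partial_deriv b f) (r *\<^sub>R e) = ?g1 r / r" if b: "b \<in> Basis" "b \<noteq> e" for b
  proof -
    have eb: "e \<bullet> b = 0" using b e by (simp add: inner_Basis)
    have "partial_deriv b (partial_deriv b f) (r *\<^sub>R e) =
       partial_deriv b (\<lambda>y. (\<lambda>s. ?g1 s / s) (norm y) * (y \<bullet> b)) (r *\<^sub>R e)"
      by (rule partial_deriv_cong[OF S x]) (simp add: pb)
    also have "\<dots> = ?g1 r / r"
    proof -
      obtain c where "((\<lambda>s. ?g1 s / s) has_real_derivative c) (at r)"
        using DERIV_divide[OF g1[OF r] DERIV_ident] r by blast
      then have "((\<lambda>y. (\<lambda>s. ?g1 s / s) (norm y)) has_derivative (\<lambda>h. c * (h \<bullet> sgn (r *\<^sub>R e)))) (at (r *\<^sub>R e))"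
        using r e by (intro dn) auto
      then have "((\<lambda>y. (\<lambda>s. ?g1 s / s) (norm y) * (y \<bullet> b)) has_derivative
         (\<lambda>h. ?g1 (norm (r *\<^sub>R e)) / norm (r *\<^sub>R e) * (h \<bullet> b) + c * (h \<bullet> sgn (r *\<^sub>R e)) * ((r *\<^sub>R e) \<bullet> b))) (at (r *\<^sub>R e))"
        by (rule has_derivative_mult) (auto intro!: derivative_eq_intros)
      from partial_deriv_eq[OF this, of b] show ?thesis using r e b eb by simp
    qed
    finally show ?thesis .
  qed
  have "laplacian f (r *\<^sub>R e) = partial_deriv e (partial_deriv e f) (r *\<^sub>R e) + (\<Sum>b\<in>Basis - {e}. ?g1 r / r)"
    unfolding laplacian_def by (subst sum.remove[OF finite_Basis e]) (simp add: pbb)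
  also have "(\<Sum>b\<in>Basis - {e}. ?g1 r / r) = (real DIM('a) - 1) * ?g1 r / r"
    using e by (simp add: card_Diff_singleton of_nat_diff DIM_positive Suc_leI)
  finally show "(?g1 has_real_derivative laplacian f (r *\<^sub>R e) - (real DIM('a) - 1) * ?g1 r / r) (at r)"
    using g1[OF r] by simp
qed

text \<open>m^2 and n^2 are the roots of X^2 - (\<alpha>^2 + \<beta>^2) X + \<alpha>^2 \<beta>^2 -
  c. The upper bound on c makes n real, and c > 0 pushes n below \<beta> (and m above |\<alpha>|).
  It is applied with \<alpha> = \<beta> + 2 and c = 2 \<open>L\<close>.\<close>

lemma biquadratic_roots:
  fixes \<alpha> \<beta> c :: real
  assumes "0 < \<beta>" "0 < c" "c \<le> \<alpha>\<^sup>2 * \<beta>\<^sup>2"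
  obtains m n where "0 \<le> n" "n < \<beta>" "n \<le> m" "m\<^sup>2 + n\<^sup>2 = \<alpha>\<^sup>2 + \<beta>\<^sup>2" "m\<^sup>2 * n\<^sup>2 = \<alpha>\<^sup>2 * \<beta>\<^sup>2 - c"
proof -
  define A where "A = \<alpha>\<^sup>2 + \<beta>\<^sup>2"
  define D where "D = (\<alpha>\<^sup>2 - \<beta>\<^sup>2)\<^sup>2 + 4 * c"
  have D: "0 \<le> D" using assms by (simp add: D_def)
  have sq: "(sqrt D)\<^sup>2 = D" using D by simp
  have DA: "A\<^sup>2 - D = 4 * (\<alpha>\<^sup>2 * \<beta>\<^sup>2 - c)" by (simp add: A_def D_def power2_eq_square algebra_simps)
  have A: "0 \<le> A" by (simp add: A_def)
  have DleA: "sqrt D \<le> A" using DA assms(3) A by (intro real_le_lsqrt) (auto simp: power2_eq_square)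
  have gt: "\<alpha>\<^sup>2 - \<beta>\<^sup>2 < sqrt D" using assms(2) by (intro real_less_rsqrt) (simp add: D_def)
  define m n where "m = sqrt ((A + sqrt D) / 2)" and "n = sqrt ((A - sqrt D) / 2)"
  have m2: "m\<^sup>2 = (A + sqrt D) / 2" and n2: "n\<^sup>2 = (A - sqrt D) / 2"
    using A D DleA by (simp_all add: m_def n_def)
  show ?thesis
  proof (rule that[of n m])
    show "0 \<le> n" using DleA by (simp add: n_def)
    show "n < \<beta>" unfolding n_def using gt assms(1) by (intro real_less_lsqrt) (auto simp: A_def)
    show "n \<le> m" unfolding m_def n_def using D by (intro real_sqrt_le_mono) simp
    show "m\<^sup>2 + n\<^sup>2 = \<alpha>\<^sup>2 + \<beta>\<^sup>2" by (simp add: m2 n2 A_def field_simps)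
    show "m\<^sup>2 * n\<^sup>2 = \<alpha>\<^sup>2 * \<beta>\<^sup>2 - c"
    proof -
      have "m\<^sup>2 * n\<^sup>2 = (A\<^sup>2 - (sqrt D)\<^sup>2) / 4"
        unfolding m2 n2 by (simp only: power2_eq_square) (simp add: field_simps)
      then show ?thesis using DA by (simp add: sq)
    qed
  qed
qed

text \<open>The tangent-line inequality 1 / v^2 >= 1 / s^2 - 2 (v - s) / s^3, multiplied by
  s^3.\<close>

lemma inverse_square_convexity:
  fixes v s :: real assumes "0 < v" "0 < s" shows "s - s ^ 3 / v\<^sup>2 \<le> 2 * (v - s)"
proof -
  have "0 \<le> (v - s)\<^sup>2 * (2 * v + s)" using assms by simp
  also have "\<dots> = 2 * (v - s) * v\<^sup>2 - s * v\<^sup>2 + s ^ 3"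
    by (simp add: power2_eq_square power3_eq_cube algebra_simps)
  finally have "(s - 2 * (v - s)) * v\<^sup>2 \<le> s ^ 3" by (simp add: algebra_simps)
  then have "s - 2 * (v - s) \<le> s ^ 3 / v\<^sup>2" using assms by (simp add: pos_le_divide_eq)
  then show ?thesis by simp
qed

text \<open>The point is the largest one with f <= 0; f is positive immediately to its right, which
  excludes a negative slope there.\<close>

lemma last_upcrossing:
  fixes f f' :: "real \<Rightarrow> real"
  assumes "a < b" "\<And>x. x \<in> {a..b} \<Longrightarrow> (f has_real_derivative f' x) (at x)" "f a < 0" "0 < f b"
  obtains x where "a < x" "x < b" "f x = 0" "0 \<le> f' x"
proof -
  have cont: "continuous_on {a..b} f"
    using assms(2) by (meson DERIV_continuous_on has_field_derivative_at_within)
  define Z where "Z = {a..b} \<inter> f -` {..0}"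
  have "closed Z" unfolding Z_def by (intro continuous_closed_preimage cont) auto
  then have "compact Z"
    unfolding compact_eq_bounded_closed by (auto simp: Z_def intro: bounded_subset[OF bounded_closed_interval[of a b]])
  moreover have "a \<in> Z" using assms by (simp add: Z_def)
  ultimately obtain x where x: "x \<in> Z" and max: "\<And>y. y \<in> Z \<Longrightarrow> y \<le> x"
    using compact_attains_sup[of Z] by blast
  have xab: "x \<in> {a..b}" and fx: "f x \<le> 0" using x by (auto simp: Z_def)
  have pos: "0 < f y" if "x < y" "y \<le> b" for y using max[of y] that xab by (force simp: Z_def)
  have "x \<noteq> b" using fx assms(4) by auto
  then have xb: "x < b" using xab by simp
  have f0: "f x = 0"
  proof (rule ccontr)
    assume "f x \<noteq> 0"
    with fx have "f x < 0" by simp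
    obtain y where "x \<le> y" "y \<le> b" "f y = 0"
      using IVT'[of f x 0 b] fx assms(4) xb xab continuous_on_subset[OF cont, of "{x..b}"] by auto
    with pos[of y] \<open>f x \<noteq> 0\<close> show False by (cases "x = y") auto
  qed
  moreover have "0 \<le> f' x"
  proof (rule ccontr)
    assume "\<not> 0 \<le> f' x"
    with DERIV_neg_dec_right[OF assms(2)[OF xab]] obtain d where d: "0 < d" "\<And>h. 0 < h \<Longrightarrow> h < d \<Longrightarrow> f (x + h) < f x"
      by auto
    define h where "h = min (d / 2) (b - x)"
    have "0 < h" "h < d" "x + h \<le> b" using d(1) xb by (auto simp: h_def)
    with d(2)[of h] pos[of "x + h"] f0 show False by simp
  qed
  moreover have "a \<noteq> x" using f0 assms(3) by auto
  ultimately show ?thesis using that[of x] xab xb by auto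
qed

section \<open>Comparison with the singular solution\<close>

lemma decreasing_from_limit:
  fixes f f' :: "real \<Rightarrow> real"
  assumes "\<And>x. 0 < x \<Longrightarrow> x \<le> R \<Longrightarrow> (f has_real_derivative f' x) (at x)"
    "\<And>x. 0 < x \<Longrightarrow> x \<le> R \<Longrightarrow> f' x \<le> 0" "(f \<longlongrightarrow> 0) (at_right 0)" "0 < x" "x \<le> R"
  shows "f x \<le> 0"
proof (rule tendsto_lowerbound[OF assms(3)])
  have "f x \<le> f y" if "0 < y" "y < x" for y
    using that assms(5) by (intro DERIV_nonpos_imp_nonincreasing[of y x f]) (auto intro!: exI assms)
  then show "\<forall>\<^sub>F y in at_right 0. f x \<le> f y"
    unfolding eventually_at_right_field using assms(4) by blast
qed simp

text \<open>The integrating factor of \<theta> + a, where \<theta> = x d/dx: \<theta> (x^a f) = x^a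
  (\<theta> + a) f.\<close>

lemma powr_times_deriv:
  fixes f :: "real \<Rightarrow> real"
  assumes "0 < x" "(f has_real_derivative g / x) (at x)"
  shows "((\<lambda>x. x powr a * f x) has_real_derivative x powr a * (g + a * f x) / x) (at x)"
  using assms by (auto intro!: derivative_eq_intros simp: powr_diff field_simps)

text \<open>With \<open>\<theta> = r d/dr\<close>, the hypothesis on \<open>k\<^sub>3\<close> says
  \<open>(\<theta> + m) (\<theta> + n) (\<theta> - m) (\<theta> - n) k \<le> 0\<close>; the first-order factors are integrated one by one from \<open>r = 0\<close>.\<close>

lemma fourth_order_euler_comparison:
  fixes k :: "nat \<Rightarrow> real \<Rightarrow> real" and k4 :: "real \<Rightarrow> real"
  assumes mn: "0 \<le> n" "n \<le> m" and R: "0 < R"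
    and k: "\<And>i x. i < 3 \<Longrightarrow> 0 < x \<Longrightarrow> x \<le> R \<Longrightarrow> (k i has_real_derivative k (Suc i) x / x) (at x)"
    and k3: "\<And>x. 0 < x \<Longrightarrow> x \<le> R \<Longrightarrow> (k 3 has_real_derivative k4 x / x) (at x)"
    and le: "\<And>x. 0 < x \<Longrightarrow> x \<le> R \<Longrightarrow> k4 x \<le> (m\<^sup>2 + n\<^sup>2) * k 2 x - m\<^sup>2 * n\<^sup>2 * k 0 x"
    and lim: "\<And>i. i < 4 \<Longrightarrow> ((\<lambda>x. x powr (-n) * k i x) \<longlongrightarrow> 0) (at_right 0)"
    and bc: "k 0 R = 0" "k 1 R \<ge> 0" and x: "0 < x" "x \<le> R"
  shows "k 0 x = 0"
proof -
  have k0: "(k 0 has_real_derivative k 1 x / x) (at x)" and k1: "(k 1 has_real_derivative k 2 x / x) (at x)"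
    and k2: "(k 2 has_real_derivative k 3 x / x) (at x)" if "0 < x" "x \<le> R" for x
    using k[of 0 x] k[of 1 x] k[of 2 x] that by (simp_all add: numeral_eq_Suc)
  \<comment> \<open>The hypothesis concerns the most singular weight, exponent -n; a nonnegative
    exponent differing from -n exceeds it by a positive power of x.\<close>
  have lim': "((\<lambda>x. x powr a * k i x) \<longlongrightarrow> 0) (at_right 0)" if i: "i < 4" and a: "a \<ge> 0 \<or> a = -n" for i a
  proof (cases "a = -n")
    case False
    with a mn have "((\<lambda>x::real. x powr (a + n)) \<longlongrightarrow> 0 powr (a + n)) (at_right 0)"
      by (intro tendsto_powr' tendsto_intros) (auto simp: eventually_at_filter)
    from tendsto_mult[OF this lim[OF i]] have "((\<lambda>x. x powr (a + n) * (x powr (-n) * k i x)) \<longlongrightarrow> 0) (at_right 0)"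
      by simp
    then show ?thesis
      by (rule Lim_transform_eventually) (simp add: eventually_at_right_less powr_add powr_minus field_simps
            eventually_at_filter)
  qed (use lim[OF i] in simp)
  \<comment> \<open>Partial products of the factorisation: \<open>E\<close> = (\<theta> - m) k,
    \<open>F\<close> = (\<theta> - n) \<open>E\<close> and \<open>M\<close> = (\<theta> + n)
    \<open>F\<close>. The hypothesis \<open>le\<close> says (\<theta> + m) \<open>M\<close> <=
    0.\<close>
  define M where "M x = k 3 x - m * k 2 x - n\<^sup>2 * k 1 x + m * n\<^sup>2 * k 0 x" for x
  define F where "F x = k 2 x - (m + n) * k 1 x + m * n * k 0 x" for x
  define E where "E x = k 1 x - m * k 0 x" for x
  have limM: "((\<lambda>x. x powr m * M x) \<longlongrightarrow> 0) (at_right 0)"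
  proof -
    have "((\<lambda>x. x powr m * k 3 x - m * (x powr m * k 2 x) - n\<^sup>2 * (x powr m * k 1 x) + m * n\<^sup>2 * (x powr m * k 0 x)) \<longlongrightarrow>
       0 - m * 0 - n\<^sup>2 * 0 + m * n\<^sup>2 * 0) (at_right 0)"
      using mn by (intro tendsto_intros lim') auto
    then show ?thesis by (simp add: M_def algebra_simps)
  qed
  have limF: "((\<lambda>x. x powr n * F x) \<longlongrightarrow> 0) (at_right 0)"
  proof -
    have "((\<lambda>x. x powr n * k 2 x - (m + n) * (x powr n * k 1 x) + m * n * (x powr n * k 0 x)) \<longlongrightarrow>
       0 - (m + n) * 0 + m * n * 0) (at_right 0)"
      using mn by (intro tendsto_intros lim') auto
    then show ?thesis by (simp add: F_def algebra_simps)
  qed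
  have limE: "((\<lambda>x. x powr (-n) * E x) \<longlongrightarrow> 0) (at_right 0)"
  proof -
    have "((\<lambda>x. x powr (-n) * k 1 x - m * (x powr (-n) * k 0 x)) \<longlongrightarrow> 0 - m * 0) (at_right 0)"
      using mn by (intro tendsto_intros lim') auto
    then show ?thesis by (simp add: E_def algebra_simps)
  qed
  have dE: "((\<lambda>x. x powr (-n) * E x) has_real_derivative x powr (-n) * F x / x) (at x)"
    if "0 < x" "x \<le> R" for x
  proof -
    have "(E has_real_derivative (k 2 x - m * k 1 x) / x) (at x)"
      unfolding E_def using k0[OF that] k1[OF that] that
      by (auto intro!: derivative_eq_intros simp: field_simps)
    from powr_times_deriv[OF that(1) this, of "-n"] show ?thesis
      by (simp add: F_def E_def algebra_simps)
  qed
  have dF: "((\<lambda>x. x powr n * F x) has_real_derivative x powr n * M x / x) (at x)"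
    if "0 < x" "x \<le> R" for x
  proof -
    have "(F has_real_derivative (k 3 x - (m + n) * k 2 x + m * n * k 1 x) / x) (at x)"
      unfolding F_def using k0[OF that] k1[OF that] k2[OF that] that
      by (auto intro!: derivative_eq_intros simp: field_simps)
    from powr_times_deriv[OF that(1) this, of n] show ?thesis
      by (simp add: F_def M_def algebra_simps power2_eq_square)
  qed
  have dM: "((\<lambda>x. x powr m * M x) has_real_derivative
      x powr m * (k4 x - (m\<^sup>2 + n\<^sup>2) * k 2 x + m\<^sup>2 * n\<^sup>2 * k 0 x) / x) (at x)"
    if "0 < x" "x \<le> R" for x
  proof -
    have "(M has_real_derivative (k4 x - m * k 3 x - n\<^sup>2 * k 2 x + m * n\<^sup>2 * k 1 x) / x) (at x)"
      unfolding M_def using k0[OF that] k1[OF that] k2[OF that] k3[OF that] that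
      by (auto intro!: derivative_eq_intros simp: field_simps)
    from powr_times_deriv[OF that(1) this, of m] show ?thesis
      by (simp add: M_def algebra_simps power2_eq_square)
  qed
  have M: "M x \<le> 0" if "0 < x" "x \<le> R" for x
  proof -
    have "k4 x - (m\<^sup>2 + n\<^sup>2) * k 2 x + m\<^sup>2 * n\<^sup>2 * k 0 x \<le> 0" if "0 < x" "x \<le> R" for x
      using le[OF that] by simp
    then have "x powr m * M x \<le> 0"
      by (intro decreasing_from_limit[OF dM _ limM that] divide_nonpos_pos mult_nonneg_nonpos) auto
    then show ?thesis using that by (simp add: mult_le_0_iff)
  qed
  have F: "F x \<le> 0" if "0 < x" "x \<le> R" for x
  proof -
    have "x powr n * F x \<le> 0"
      using M by (intro decreasing_from_limit[OF dF _ limF that])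
        (auto intro!: divide_nonpos_pos mult_nonneg_nonpos)
    then show ?thesis using that by (simp add: mult_le_0_iff)
  qed
  have sgnF: "x powr (-n) * F x / x \<le> 0" if "0 < x" "x \<le> R" for x
    using F[OF that] that by (auto intro!: divide_nonpos_pos mult_nonneg_nonpos)
  \<comment> \<open>The weighted \<open>E\<close> decreases from the limit 0 at the origin, yet the
    boundary conditions make it nonnegative at R; it is therefore 0 in between.\<close>
  have E: "E x = 0" if "0 < x" "x \<le> R" for x
  proof -
    have "x powr (-n) * E x \<le> 0"
      by (rule decreasing_from_limit[OF dE sgnF limE that])
    moreover have "R powr (-n) * E R \<le> x powr (-n) * E x"
    proof (cases "x = R")
      case False
      with that show ?thesis
        by (intro DERIV_nonpos_imp_nonincreasing[of x R "\<lambda>x. x powr (-n) * E x"])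
           (auto intro!: exI dE sgnF simp del: powr_minus)
    qed simp
    moreover have "R powr (-n) * E R \<ge> 0" using bc by (simp add: E_def)
    ultimately have "x powr (-n) * E x = 0" by linarith
    then show ?thesis using that by simp
  qed
  \<comment> \<open>No limit of x powr (-m) * k at 0 is available, so the last factor is integrated
    from R, where k vanishes.\<close>
  have d: "((\<lambda>x. x powr (-m) * k 0 x) has_real_derivative 0) (at x)" if "0 < x" "x \<le> R" for x
    using powr_times_deriv[OF that(1) k0[OF that], of "-m"] E[OF that] by (simp add: E_def)
  obtain c where c: "\<And>y. y \<in> {x..R} \<Longrightarrow> y powr (-m) * k 0 y = c"
    using has_field_derivative_zero_constant[of "{x..R}" "\<lambda>x. x powr (-m) * k 0 x"] d x
    by (meson atLeastAtMost_iff convex_closed_interval convex_real_interval(5) has_field_derivative_at_within less_le_trans)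
  have "x powr (-m) * k 0 x = R powr (-m) * k 0 R"
    using c[of x] c[of R] x by simp
  then show ?thesis using bc x by simp
qed

lemma minimal_solution_le_power:
  fixes u :: "'a::euclidean_space \<Rightarrow> real"
  defines "N \<equiv> real DIM('a)"
  assumes dim: "9 \<le> DIM('a)" and l: "8/9 * (N - 2/3) * (N - 8/3) \<le> l"
    and u: "minimal_solution l u" and x: "x \<in> ball 0 1"
  shows "u x \<le> 1 - norm x powr (4/3)"
proof (rule ccontr)
  assume contra: "\<not> u x \<le> 1 - norm x powr (4/3)"
  have N: "9 \<le> N" using dim by (simp add: N_def)
  define L where "L = 8/9 * (N - 2/3) * (N - 8/3)"
  have L: "0 < L" "L \<le> l" using N l by (simp_all add: L_def)
  obtain e :: 'a where e: "e \<in> Basis" using nonempty_Basis by blast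
  have C4: "C_k_on (Suc (Suc 2)) u (ball 0 1)" and C1: "C_k_on (Suc 0) u (cball 0 1)"
    and eq: "\<And>y. y \<in> ball 0 1 \<Longrightarrow> laplacian (laplacian u) y = l / (1 - u y)\<^sup>2"
    and bd: "\<And>y. y \<in> ball 0 1 \<Longrightarrow> u y < 1"
    and bc: "\<And>y. y \<in> sphere 0 1 \<Longrightarrow> u y = 0 \<and> normal_deriv u y = 0"
    using u by (simp_all add: minimal_solution_def classical_solution_def numeral_eq_Suc del: C_k_on.simps)
  have C2: "C_k_on (Suc (Suc 0)) u (ball 0 1)" by (rule C_k_on_le[OF C4]) simp
  have L2: "C_k_on (Suc (Suc 0)) (laplacian u) (ball 0 1)"
    using C_k_on_laplacian[OF open_ball C4] by (simp only: numeral_2_eq_2)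
  define g g1 z z1 where "g r = u (r *\<^sub>R e)" and "g1 r = partial_deriv e u (r *\<^sub>R e)"
    and "z r = laplacian u (r *\<^sub>R e)" and "z1 r = partial_deriv e (laplacian u) (r *\<^sub>R e)" for r
  have inb: "r *\<^sub>R e \<in> ball 0 1" if "0 \<le> r" "r < 1" for r using that e by simp
  have dg: "(g has_real_derivative g1 r) (at r)" "(g1 has_real_derivative z r - (N - 1) * g1 r / r) (at r)"
    "(z has_real_derivative z1 r) (at r)" "(z1 has_real_derivative l / (1 - g r)\<^sup>2 - (N - 1) * z1 r / r) (at r)"
    if r: "0 < r" "r < 1" for r
    using radial_function_ode[OF C2 minimal_solution_radial(1)[OF u _ _] e r]
      radial_function_ode[OF L2 minimal_solution_radial(2)[OF u _ _] e r] eq[OF inb[OF less_imp_le[OF r(1)] r(2)]]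
    unfolding g_def[abs_def] g1_def[abs_def] z_def[abs_def] z1_def[abs_def] N_def by simp_all
  \<comment> \<open>The weight r^\<beta> makes the indicial polynomial even: r^4 times the radial
    bilaplacian is \<theta> (\<theta> + N - 2) (\<theta> - 2) (\<theta> + N - 4), and conjugation by
    r^\<beta> turns it into (\<theta>^2 - (\<beta> + 2)^2) (\<theta>^2 - \<beta>^2).\<close>
  define \<beta> where "\<beta> = N / 2 - 2"
  have N': "N = 2 * \<beta> + 4" by (simp add: \<beta>_def)
  have \<beta>: "5/2 \<le> \<beta>" using N by (simp add: \<beta>_def)
  define s where "s r = r powr (4/3)" for r :: real
  \<comment> \<open>With \<open>\<theta> = r d/dr\<close>: \<open>d1 = \<theta> d0\<close>, \<open>d2 = r\<^sup>2 \<Delta> d0\<close>, \<open>d3 = (\<theta> - 2) d2\<close>.\<close>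
  define d0 where "d0 r = 1 - g r - s r" for r
  define d1 where "d1 r = - r * g1 r - 4/3 * s r" for r
  define d2 where "d2 r = - (r\<^sup>2) * z r - 4/3 * (N - 2/3) * s r" for r
  define d3 where "d3 r = - (r ^ 3) * z1 r + 8/9 * (N - 2/3) * s r" for r
  \<comment> \<open>r^4 times the bilaplacian of \<open>d0\<close>, that is (\<theta> + N - 4)
    \<open>d3\<close>; the part L s comes from the power function, the other from the equation for
    u.\<close>
  define E where "E r = L * s r - r ^ 4 * l / (1 - g r)\<^sup>2" for r
  have ds: "(s has_real_derivative (4/3 * s r) / r) (at r)" if "0 < r" for r
    unfolding s_def[abs_def] using that powr_diff[of r "4/3" 1] by (auto intro!: derivative_eq_intros)
  have dd0: "(d0 has_real_derivative d1 r / r) (at r)" if r: "0 < r" "r < 1" for r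
    unfolding d0_def[abs_def] d1_def
    by (rule derivative_eq_intros dg ds r refl)+ (use r in \<open>simp add: field_simps\<close>)
  have dd1: "(d1 has_real_derivative (d2 r - (N - 2) * d1 r) / r) (at r)" if r: "0 < r" "r < 1" for r
    unfolding d1_def[abs_def] d2_def
    by (rule derivative_eq_intros dg ds r refl)+ (use r in \<open>simp add: field_simps power2_eq_square\<close>)
  have dd2: "(d2 has_real_derivative (2 * d2 r + d3 r) / r) (at r)" if r: "0 < r" "r < 1" for r
    unfolding d2_def[abs_def] d3_def
    by (rule derivative_eq_intros dg ds r refl)+ (use r in \<open>simp add: field_simps eval_nat_numeral\<close>)
  have dd3: "(d3 has_real_derivative ((4 - N) * d3 r + E r) / r) (at r)" if r: "0 < r" "r < 1" for r
    unfolding d3_def[abs_def] E_def L_def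
    by (rule derivative_eq_intros dg ds r refl)+ (use r in \<open>simp add: field_simps eval_nat_numeral\<close>)
  \<comment> \<open>L <= l allows l to be replaced by L, and s^3 = r^4 makes the coefficient of the
    tangent-line bound the constant 2 L.\<close>
  have E: "E r \<le> 2 * L * d0 r" if r: "0 < r" "r < 1" for r
  proof -
    have v: "0 < 1 - g r" using bd[OF inb[of r]] r by (simp add: g_def)
    have s3: "s r ^ 3 = r ^ 4" using r by (simp add: s_def powr_power)
    have "E r \<le> L * s r - r ^ 4 * L / (1 - g r)\<^sup>2"
      unfolding E_def using L by (intro diff_left_mono divide_right_mono mult_left_mono) auto
    also have "\<dots> = L * (s r - s r ^ 3 / (1 - g r)\<^sup>2)" by (simp add: s3 algebra_simps)
    also have "\<dots> \<le> L * (2 * (1 - g r - s r))"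
      using L v r by (intro mult_left_mono inverse_square_convexity) (auto simp: s_def)
    finally show ?thesis by (simp add: d0_def algebra_simps)
  qed
  define r0 where "r0 = norm x"
  \<comment> \<open>Since \<open>0 powr (4/3)\<close> is 0, the negated bound at the origin would
    read u 0 > 1.\<close>
  have "x \<noteq> 0" using contra bd[of 0] by auto
  then have r0: "0 < r0" "r0 < 1" using x by (auto simp: r0_def)
  have "u x = g r0"
    unfolding g_def using x e by (intro minimal_solution_radial(1)[OF u]) (auto simp: r0_def)
  then have dr0: "d0 r0 < 0" using contra by (simp add: d0_def s_def r0_def)
  obtain r1 where r1: "r0 < r1" "r1 < 1" "0 < d0 r1"
  proof -
    have ec: "1 *\<^sub>R e \<in> cball 0 1" using e by simp
    have "(u has_derivative frechet_derivative u (at (1 *\<^sub>R e) within cball 0 1)) (at (1 *\<^sub>R e) within cball 0 1)"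
      by (rule C_k_on_has_derivative[OF C1 ec])
    moreover have "(\<lambda>r. r *\<^sub>R e) ` {0..1} \<subseteq> cball 0 1" using e by auto
    ultimately have du: "(u has_derivative frechet_derivative u (at e within cball 0 1)) (at (1 *\<^sub>R e) within (\<lambda>r. r *\<^sub>R e) ` {0..1})"
      using has_derivative_subset by force
    interpret D: bounded_linear "frechet_derivative u (at e within cball 0 1)"
      using du by (rule has_derivative_bounded_linear)
    have "((\<lambda>r. r *\<^sub>R e) has_derivative (\<lambda>h. h *\<^sub>R e)) (at 1 within {0..1})"
      by (auto intro!: derivative_eq_intros)
    from has_derivative_in_compose[OF this du]
    have "((\<lambda>r. u (r *\<^sub>R e)) has_derivative (\<lambda>h. h * frechet_derivative u (at e within cball 0 1) e)) (at 1 within {0..1})"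
      by (simp add: D.scaleR)
    moreover have "frechet_derivative u (at e within cball 0 1) e = 0"
      using bc[of e] e by (simp add: normal_deriv_def)
    ultimately have "(g has_real_derivative 0) (at 1 within {0..1})"
      by (simp add: has_field_derivative_def g_def[abs_def] lambda_zero)
    moreover have "(s has_real_derivative 4/3) (at 1 within {0..1})"
      using ds[of 1] by (simp add: s_def has_field_derivative_at_within)
    ultimately have "(d0 has_real_derivative 0 - 0 - 4/3) (at 1 within {0..1})"
      unfolding d0_def[abs_def] by (intro DERIV_diff DERIV_const)
    then obtain \<delta> where \<delta>: "0 < \<delta>" "\<And>h. 0 < h \<Longrightarrow> 1 - h \<in> {0..1} \<Longrightarrow> h < \<delta> \<Longrightarrow> d0 1 < d0 (1 - h)"
      using has_real_derivative_neg_dec_left[of d0 "0 - 0 - 4/3" 1 "{0..1}"] by auto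
    have "d0 1 = 0" using bc[of e] e by (simp add: d0_def g_def s_def)
    define h where "h = min (\<delta> / 2) ((1 - r0) / 2)"
    have h: "0 < h" "h < \<delta>" "h < 1 - r0" using \<delta>(1) r0 by (auto simp: h_def min_def)
    then show ?thesis using \<delta>(2)[of h] r0 \<open>d0 1 = 0\<close> by (intro that[of "1 - h"]) auto
  qed
  obtain R where R: "r0 < R" "R < r1" "d0 R = 0" "0 \<le> d1 R / R"
    using last_upcrossing[of r0 r1 d0 "\<lambda>r. d1 r / r"] r1 r0 dr0 dd0 by force
  have R01: "0 < R" "R < 1" using R r0 r1 by auto
  have d1R: "0 \<le> d1 R" using R(4) R01 by (simp add: zero_le_divide_iff)
  \<comment> \<open>The aim is 32 L <= w^2, the Hardy-Rellich condition 2 L <= N^2 (N - 4)^2 / 16.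
    Writing 81 L as 72 w plus lower-order terms and using w >= 45 and w >= 5 N, both from N >= 9,
    gives 32 L <= 45 w <= w^2.\<close>
  define w where "w = N * (N - 4)"
  have w1: "45 \<le> w" using mult_mono[of 9 N 5 "N - 4"] N by (simp add: w_def)
  have w2: "5 * N \<le> w" using mult_right_mono[of 5 "N - 4" N] N by (simp add: w_def mult.commute)
  have ww: "45 * w \<le> w * w" using w1 by (intro mult_right_mono) auto
  have "81 * L = 72 * w + 48 * N + 128" by (simp add: L_def w_def field_simps)
  then have "32 * L * 81 \<le> 45 * w * 81" using w1 w2 by linarith
  then have "32 * L \<le> w * w" using ww by linarith
  then have "2 * L \<le> (N * (N - 4))\<^sup>2 / 16" by (simp add: w_def power2_eq_square)
  also have "\<dots> = (\<beta> + 2)\<^sup>2 * \<beta>\<^sup>2" by (simp add: N' power2_eq_square algebra_simps)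
  finally have disc: "2 * L \<le> (\<beta> + 2)\<^sup>2 * \<beta>\<^sup>2" .
  have "0 < \<beta>" "0 < 2 * L" using \<beta> L by simp_all
  from biquadratic_roots[OF this disc] obtain m n where mn: "0 \<le> n" "n < \<beta>" "n \<le> m" "m\<^sup>2 + n\<^sup>2 = (\<beta> + 2)\<^sup>2 + \<beta>\<^sup>2"
    "m\<^sup>2 * n\<^sup>2 = (\<beta> + 2)\<^sup>2 * \<beta>\<^sup>2 - 2 * L"
    by blast
  \<comment> \<open>\<open>r powr \<beta> * a i r\<close> is \<open>\<theta>\<^sup>i\<close> applied to \<open>r powr \<beta> * d0 r\<close>.\<close>
  define a where "a i r = [d0 r, d1 r + \<beta> * d0 r, d2 r - 2 * d1 r + \<beta>\<^sup>2 * d0 r,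
     d3 r + \<beta> * d2 r + (\<beta>\<^sup>2 + 2 * \<beta> + 4) * d1 r + \<beta> ^ 3 * d0 r] ! i" for i r
  \<comment> \<open>The fourth power of \<theta> on r^\<beta> \<open>d0\<close>, divided by
    r^\<beta>, obtained by solving (\<theta>^2 - (\<beta> + 2)^2) (\<theta>^2 - \<beta>^2)
    (r^\<beta> \<open>d0\<close>) = r^\<beta> \<open>E\<close> for the top-order term.\<close>
  define a4 where "a4 r = E r + (2 * \<beta>\<^sup>2 + 4 * \<beta> + 4) * a 2 r - (\<beta> ^ 4 + 4 * \<beta> ^ 3 + 4 * \<beta>\<^sup>2) * d0 r" for r
  have da0: "(a 0 has_real_derivative (a 1 r - \<beta> * a 0 r) / r) (at r)"
    and da1: "(a 1 has_real_derivative (a 2 r - \<beta> * a 1 r) / r) (at r)"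
    and da2: "(a 2 has_real_derivative (a 3 r - \<beta> * a 2 r) / r) (at r)"
    and da3: "(a 3 has_real_derivative (a4 r - \<beta> * a 3 r) / r) (at r)" if r: "0 < r" "r < 1" for r
  proof -
    note D = dd0[OF r] dd1[OF r] dd2[OF r] dd3[OF r]
    show "(a 0 has_real_derivative (a 1 r - \<beta> * a 0 r) / r) (at r)"
      unfolding a_def[abs_def] by (simp add: D)
    show "(a 1 has_real_derivative (a 2 r - \<beta> * a 1 r) / r) (at r)"
      unfolding a_def[abs_def] using r
      by (auto intro!: derivative_eq_intros D simp: N' power2_eq_square field_simps)
    show "(a 2 has_real_derivative (a 3 r - \<beta> * a 2 r) / r) (at r)"
      unfolding a_def[abs_def] using r
      by (auto intro!: derivative_eq_intros D simp: N' eval_nat_numeral field_simps)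
    show "(a 3 has_real_derivative (a4 r - \<beta> * a 3 r) / r) (at r)"
      unfolding a_def[abs_def] a4_def using r
      by (auto intro!: derivative_eq_intros D simp: N' eval_nat_numeral field_simps)
  qed
  have da: "(a i has_real_derivative (a (Suc i) r - \<beta> * a i r) / r) (at r)" if "i < 3" "0 < r" "r < 1" for i r
    using that da0 da1 da2 by (auto simp: less_Suc_eq numeral_eq_Suc)
  have at0: "((\<lambda>r. f (r *\<^sub>R e)) \<longlongrightarrow> f 0) (at_right 0)" if "C_k_on 0 f (ball 0 1)" for f :: "'a \<Rightarrow> real"
  proof -
    have "isCont f 0" using that by (simp add: continuous_on_eq_continuous_at)
    moreover have "((\<lambda>r. r *\<^sub>R e) \<longlongrightarrow> 0) (at_right 0)" by (auto intro!: tendsto_eq_intros)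
    ultimately show ?thesis by (rule isCont_tendsto_compose)
  qed
  have "C_k_on 0 (partial_deriv e u) (ball 0 1)"
    by (rule C_k_on_SucD[OF C_k_on_partial_deriv[OF open_ball C2 e]])
  moreover have "C_k_on 0 (partial_deriv e (laplacian u)) (ball 0 1)"
    by (rule C_k_on_SucD[OF C_k_on_partial_deriv[OF open_ball L2 e]])
  ultimately have lim: "(g \<longlongrightarrow> u 0) (at_right 0)" "(g1 \<longlongrightarrow> partial_deriv e u 0) (at_right 0)"
    "(z \<longlongrightarrow> laplacian u 0) (at_right 0)" "(z1 \<longlongrightarrow> partial_deriv e (laplacian u) 0) (at_right 0)"
    unfolding g_def[abs_def] g1_def[abs_def] z_def[abs_def] z1_def[abs_def]
    using C_k_on_le[OF C2, of 0] C_k_on_le[OF L2, of 0] by (intro at0; simp)+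
  have lims: "(s \<longlongrightarrow> 0) (at_right 0)"
    unfolding s_def[abs_def] by (rule tendsto_eq_intros tendsto_powr' refl)+ (auto simp: eventually_at_filter)
  have limd: "(d0 \<longlongrightarrow> 1 - u 0) (at_right 0)" "(d1 \<longlongrightarrow> 0) (at_right 0)" "(d2 \<longlongrightarrow> 0) (at_right 0)"
    "(d3 \<longlongrightarrow> 0) (at_right 0)"
    unfolding d0_def[abs_def] d1_def[abs_def] d2_def[abs_def] d3_def[abs_def]
    by (rule tendsto_eq_intros lim lims refl | simp)+
  have "\<exists>c. (a 0 \<longlongrightarrow> c) (at_right 0)" "\<exists>c. (a 1 \<longlongrightarrow> c) (at_right 0)"
    "\<exists>c. (a 2 \<longlongrightarrow> c) (at_right 0)" "\<exists>c. (a 3 \<longlongrightarrow> c) (at_right 0)"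
    unfolding a_def[abs_def] by (simp, rule exI, (rule limd tendsto_add tendsto_diff tendsto_mult_left)+)+
  then have lima: "\<exists>c. (a i \<longlongrightarrow> c) (at_right 0)" if "i < 4" for i
    using that by (auto simp: less_Suc_eq numeral_eq_Suc)
  have zero: "r powr \<beta> * a 0 r = 0" if r: "0 < r" "r \<le> R" for r
  proof (rule fourth_order_euler_comparison[of n m R "\<lambda>i r. r powr \<beta> * a i r" "\<lambda>r. r powr \<beta> * a4 r"])
    show "((\<lambda>r. r powr \<beta> * a i r) has_real_derivative r powr \<beta> * a (Suc i) r / r) (at r)"
      if "i < 3" "0 < r" "r \<le> R" for i r
      using powr_times_deriv[OF that(2) da[OF that(1,2)], of \<beta>] that R01 by simp
    show "((\<lambda>r. r powr \<beta> * a 3 r) has_real_derivative r powr \<beta> * a4 r / r) (at r)"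
      if "0 < r" "r \<le> R" for r
      using powr_times_deriv[OF that(1) da3[OF that(1)], of \<beta>] that R01 by simp
    show "r powr \<beta> * a4 r \<le> (m\<^sup>2 + n\<^sup>2) * (r powr \<beta> * a 2 r) - m\<^sup>2 * n\<^sup>2 * (r powr \<beta> * a 0 r)"
      if "0 < r" "r \<le> R" for r
    proof -
      have "a4 r \<le> (m\<^sup>2 + n\<^sup>2) * a 2 r - m\<^sup>2 * n\<^sup>2 * a 0 r"
        unfolding a4_def mn(4,5) using E[of r] that R01
        by (simp add: a_def eval_nat_numeral algebra_simps)
      then have "r powr \<beta> * a4 r \<le> r powr \<beta> * ((m\<^sup>2 + n\<^sup>2) * a 2 r - m\<^sup>2 * n\<^sup>2 * a 0 r)"
        by (intro mult_left_mono) auto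
      then show ?thesis by (simp add: algebra_simps)
    qed
    \<comment> \<open>Regularity of u at the origin enters here: each \<open>a i\<close> has a
      finite limit, and n < \<beta> leaves the positive power r^(\<beta> - n).\<close>
    show "((\<lambda>r. r powr (-n) * (r powr \<beta> * a i r)) \<longlongrightarrow> 0) (at_right 0)" if i: "i < 4" for i
    proof -
      obtain c where c: "(a i \<longlongrightarrow> c) (at_right 0)" using lima[OF i] by blast
      have "((\<lambda>r::real. r powr (\<beta> - n)) \<longlongrightarrow> 0 powr (\<beta> - n)) (at_right 0)"
        using mn by (intro tendsto_powr' tendsto_intros) (auto simp: eventually_at_filter)
      from tendsto_mult[OF this c] have "((\<lambda>r. r powr (\<beta> - n) * a i r) \<longlongrightarrow> 0) (at_right 0)" by simp
      then show ?thesis by (simp add: powr_diff powr_minus divide_inverse mult_ac)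
    qed
    show "R powr \<beta> * a 0 R = 0" "0 \<le> R powr \<beta> * a 1 R" using R(3) d1R by (simp_all add: a_def)
  qed (use mn R01 r in auto)
  have "eventually (\<lambda>r. 0 < d0 r) (at_right 0)"
    using order_tendstoD(1)[OF limd(1), of 0] bd[of 0] by simp
  moreover have "eventually (\<lambda>r. r \<in> {0<..<R}) (at_right 0)"
    using eventually_at_right_real[OF R01(1)] .
  ultimately have "eventually (\<lambda>r. False) (at_right (0::real))"
  proof eventually_elim
    case (elim r)
    then show ?case using zero[of r] by (simp add: a_def)
  qed
  then show False by simp
qed

theorem lemma4p1:
  fixes u_star :: "'a::euclidean_space \<Rightarrow> real"
  assumes "DIM('a) \<ge> 9"
    and "extremal_solution u_star"
  shows "\<forall>x\<in>ball 0 1. u_star x \<le> 1 - norm x powr (4/3)"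
proof
  fix x :: 'a assume x: "x \<in> ball 0 1"
  let ?N = "real DIM('a)" and ?L = "pull_in_voltage TYPE('a)"
  define S where "S = {l. l > 0 \<and> (\<exists>u :: 'a \<Rightarrow> real. classical_solution l u)}"
  have N: "9 \<le> ?N" using assms(1) by simp
  define b where "b = 8/9 * (?N - 2/3) * (?N - 8/3)"
  have b: "0 < b" using N by (simp add: b_def)
  have bN: "b \<le> 8/9 * ?N * (?N + 2)"
    unfolding b_def using N by (intro mult_mono) auto
  have dim3: "3 \<le> DIM('a)" using assms(1) by simp
  obtain v :: "'a \<Rightarrow> real" where "classical_solution b v"
    using exists_classical_solution[OF b bN dim3] by blast
  then have "b \<in> S" using b by (auto simp: S_def)
  \<comment> \<open>\<open>Sup\<close> of a set of reals is meaningful only if the set is bounded.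
    Together with b in S this makes the supremum positive, so parameters approaching it from the
    left are eventually positive and have minimal solutions.\<close>
  moreover have "bdd_above S"
  proof -
    obtain M where "\<And>l (u :: 'a \<Rightarrow> real). 0 < l \<Longrightarrow> classical_solution l u \<Longrightarrow> l \<le> M"
      using classical_solution_bounded by blast
    then show ?thesis by (intro bdd_aboveI[of _ M]) (auto simp: S_def)
  qed
  ultimately have "b \<le> ?L" unfolding pull_in_voltage_def S_def[symmetric] by (rule cSup_upper)
  then have L: "0 < ?L" using b by simp
  obtain U where U: "\<And>l. 0 < l \<Longrightarrow> l < ?L \<Longrightarrow> minimal_solution l (U l)"
    and lim: "((\<lambda>l. U l x) \<longlongrightarrow> u_star x) (at_left ?L)"
    using assms(2) x unfolding extremal_solution_def by blast
  have le: "U l x \<le> 1 - norm x powr (4/3)" if l: "0 < l" "l < ?L" for l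
  proof (cases "b \<le> l")
    case True
    then show ?thesis using minimal_solution_le_power[OF assms(1) _ U[OF l] x] by (simp add: b_def)
  next
    case False
    have "l \<le> 8/9 * ?N * (?N + 2)" using False bN by simp
    from exists_classical_solution[OF l(1) this dim3]
    obtain v :: "'a \<Rightarrow> real" where v: "classical_solution l v"
      "\<And>x. x \<in> ball 0 1 \<Longrightarrow> v x \<le> 1/4 * (1 - (norm x)\<^sup>2)\<^sup>2" by blast
    define r where "r = norm x"
    have r: "0 \<le> r" "r < 1" using x by (simp_all add: r_def)
    have "U l x \<le> v x" using U[OF l] v(1) x by (auto simp: minimal_solution_def)
    also have "\<dots> \<le> 1/4 * (1 - r\<^sup>2)\<^sup>2" using v(2)[OF x] by (simp add: r_def)
    \<comment> \<open>After splitting off 1 - r the remaining factor is at most 1 on [0, 1), and 1 -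
      r <= 1 - r^(4/3) there.\<close>
    also have "\<dots> = (1 - r) * ((1 - r) * ((1 + r) / 2)\<^sup>2)"
      by (simp add: power2_eq_square algebra_simps)
    also have "\<dots> \<le> (1 - r) * (1 * 1)"
      using r by (intro mult_left_mono mult_mono power_le_one) auto
    also have "\<dots> \<le> 1 - r powr (4/3)"
      using r powr_mono'[of 1 "4/3" r] by simp
    finally show ?thesis by (simp add: r_def)
  qed
  have "eventually (\<lambda>l. U l x \<le> 1 - norm x powr (4/3)) (at_left ?L)"
    unfolding eventually_at_left_field using L le by (intro exI[of _ 0]) auto
  then show "u_star x \<le> 1 - norm x powr (4/3)"
    by (rule tendsto_upperbound[OF lim]) simp
qed

end
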